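(* Let $Q$ be a Lie group of dimension $n$ and let $\overline{TQ}=TQ\times[a,b]$ be framed by a left-invariant frame of $Q$ with structure constants $c^k_{ij}$, as in the context. Let $\mathcal L$ be a smooth function on $\overline{TQ}$ such that the matrix $P_{ij}=E_{\xi^i}E_{\xi^j}\mathcal L$ is everywhere invertible, and put $p_i=E_{\xi^i}\mathcal L$, $\mathcal H=p_i\xi^i-\mathcal L$ and $\Theta=p_i\theta^i-\mathcal H\,ds$. Let $(D_{q^1},\dots,D_{q^n},D_p^1,\dots,D_p^n,D_s)$ be the frame of $\overline{TQ}$ dual to the coframe $(\theta^1,\dots,\theta^n,dp_1,\dots,dp_n,ds)$. Define $$\mathcal J=D_{q^i}\otimes D_p^i-D_p^i\otimes D_{q^i}+p_a\,c^a_{ij}\,D_p^j\otimes D_p^i,\qquad \{F,G\}=\mathcal J(dF,dG)$$ for smooth functions $F,G$ on $\overline{TQ}$ (summation over repeated indices). Then: (1) $\{\cdot,\cdot\}$ is a Poisson bracket on the smooth functions on $\overline{TQ}$: it is bilinear, antisymmetric, a derivation in each argument, and satisfies the Jacobi identity. (2) If $X$ is a vector field with $d\Theta(X,W)=0$ for every vector field $W$ on $\overline{TQ}$, and $X_s:=ds(X)$, then for every smooth function $\varphi$ on $\overline{TQ}$, $$X(\varphi)=X_s\big(\{\varphi,\mathcal H\}+D_s(\varphi)\big).$$ In particular, along an integral curve of such a vector field, parametrized by $s$, one has $\frac{d\varphi}{ds}=\{\varphi,\mathcal H\}+D_s(\varphi)$.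
   Context: $Q$ is a Lie group of dimension $n$ and $[a,b]\subset\mathbb R$. Points of $\overline{TQ}=TQ\times[a,b]$ are written $(q,X,s)$ with $q\in Q$, $X\in T_qQ$, $s\in[a,b]$; $\sigma:\overline{TQ}\to Q$ is $(q,X,s)\mapsto q$. Fix a basis of $T_eQ$, extend it to left-invariant vector fields $B_1,\dots,B_n$ on $Q$ with dual left-invariant 1-forms $\beta^1,\dots,\beta^n$; the structure constants are defined by $[B_i,B_j]=c^k_{ij}B_k$. Set $\theta^i=\sigma^\star\beta^i$ and $\xi^i(q,X,s)=\beta^i|_q(X)$. Then $(\theta^1,\dots,\theta^n,d\xi^1,\dots,d\xi^n,ds)$ is a global coframe of $\overline{TQ}$ with dual frame denoted $(E_{q^1},\dots,E_{q^n},E_{\xi^1},\dots,E_{\xi^n},E_s)$. Because $P$ is invertible, $(\theta^i,dp_i,ds)$ is also a coframe of $\overline{TQ}$. For vector fields $U,V$, $(U\otimes V)(dF,dG)=U(F)\,V(G)$. Curves tangent to the null direction of $d\Theta$ are the equilibria (critical curves) associated with the functional $\int\mathcal L\,ds$. *)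

theory Defs
  imports "HOL-Analysis.Analysis" "HOL-Algebra.Group"
begin

section \<open>Smooth maps between subsets of Euclidean spaces\<close>

primrec Ck_on :: "nat \<Rightarrow> 'a::euclidean_space set \<Rightarrow> ('a \<Rightarrow> 'b::real_normed_vector) \<Rightarrow> bool" where
  "Ck_on 0 U f \<longleftrightarrow> continuous_on U f"
| "Ck_on (Suc k) U f \<longleftrightarrow> (\<forall>x\<in>U. f differentiable (at x)) \<and>
     (\<forall>v. Ck_on k U (\<lambda>x. frechet_derivative f (at x) v))"

text \<open>Smoothness on an arbitrary set is local extendability to a smooth map on an open set. For open
  sets this is ordinary \<open>C\<^sup>\<infinity>\<close>; the general case is needed because of the factor \<open>[a,b]\<close>.\<close>

definition smooth_on :: "'a::euclidean_space set \<Rightarrow> ('a \<Rightarrow> 'b::real_normed_vector) \<Rightarrow> bool" where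
  "smooth_on S f \<longleftrightarrow> (\<forall>x\<in>S. \<exists>U g. open U \<and> x \<in> U \<and> (\<forall>k. Ck_on k U g) \<and> (\<forall>y\<in>S \<inter> U. g y = f y))"

section \<open>Atlases and smooth manifolds\<close>

text \<open>An atlas is given by local parametrizations \<open>(S, \<psi>)\<close>, i.e. inverse charts \<open>\<psi> : S \<rightarrow> M\<close>. The points
  of the manifold are those covered by the atlas. Functions and fields on the manifold are total
  HOL functions, whose values outside \<open>points A\<close> play no role.\<close>

type_synonym ('e, 'm) atlas = "('e set \<times> ('e \<Rightarrow> 'm)) set"

definition points :: "('e, 'm) atlas \<Rightarrow> 'm set" where
  "points A = (\<Union>(S, \<psi>)\<in>A. \<psi> ` S)"

definition prod_atlas :: "('e, 'm) atlas \<Rightarrow> ('f, 'k) atlas \<Rightarrow> ('e \<times> 'f, 'm \<times> 'k) atlas" where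
  "prod_atlas A B = {(S \<times> R, map_prod \<psi> \<rho>) | S \<psi> R \<rho>. (S, \<psi>) \<in> A \<and> (R, \<rho>) \<in> B}"

definition smooth_fun :: "('e::euclidean_space, 'm) atlas \<Rightarrow> ('m \<Rightarrow> real) \<Rightarrow> bool" where
  "smooth_fun A f \<longleftrightarrow> (\<forall>(S, \<psi>)\<in>A. smooth_on S (f \<circ> \<psi>))"

definition smooth_map ::
  "'m topology \<Rightarrow> ('e::euclidean_space, 'm) atlas \<Rightarrow> 'k topology \<Rightarrow> ('f::euclidean_space, 'k) atlas \<Rightarrow>
   ('m \<Rightarrow> 'k) \<Rightarrow> bool" where
  "smooth_map T A T' A' f \<longleftrightarrow> continuous_map T T' f \<and>
     (\<forall>(S, \<psi>)\<in>A. \<forall>(R, \<rho>)\<in>A'.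
        smooth_on {x \<in> S. f (\<psi> x) \<in> \<rho> ` R} (the_inv_into R \<rho> \<circ> f \<circ> \<psi>))"

definition smooth_manifold :: "'m topology \<Rightarrow> ('e::euclidean_space, 'm) atlas \<Rightarrow> bool" where
  "smooth_manifold T A \<longleftrightarrow>
     Hausdorff_space T \<and> second_countable T \<and> topspace T = points A \<and>
     (\<forall>(S, \<psi>)\<in>A. open S \<and> openin T (\<psi> ` S) \<and>
        homeomorphic_map (top_of_set S) (subtopology T (\<psi> ` S)) \<psi>) \<and>
     (\<forall>(S, \<psi>)\<in>A. \<forall>(R, \<rho>)\<in>A.
        smooth_on {x \<in> S. \<psi> x \<in> \<rho> ` R} (the_inv_into R \<rho> \<circ> \<psi>))"

locale lie_group = group G
  for G :: "('q, 'z) monoid_scheme" (structure)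
    and T :: "'q topology" and A :: "('e::euclidean_space, 'q) atlas" +
  assumes carrier_eq: "topspace T = carrier G"
    and manifold: "smooth_manifold T A"
    and smooth_mult:
      "smooth_map (prod_topology T T) (prod_atlas A A) T A (\<lambda>(x, y). x \<otimes> y)"
    and smooth_inv: "smooth_map T A T A (\<lambda>x. inv x)"

section \<open>Tangent vectors, vector fields and 1-forms\<close>

type_synonym 'm tangent = "('m \<Rightarrow> real) \<Rightarrow> real"
type_synonym 'm vfield = "'m \<Rightarrow> 'm tangent"
type_synonym 'm form1 = "'m \<Rightarrow> 'm tangent \<Rightarrow> real"

text \<open>Tangent vectors are derivations at a point; the value \<open>0\<close> at non-smooth arguments is the
  normalization that makes equality of derivations equality of HOL functions.\<close>

definition tangent_space :: "('e::euclidean_space, 'm) atlas \<Rightarrow> 'm \<Rightarrow> 'm tangent set" where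
  "tangent_space A p = {v.
     (\<forall>f g. smooth_fun A f \<longrightarrow> smooth_fun A g \<longrightarrow>
        (\<forall>r t. v (\<lambda>x. r * f x + t * g x) = r * v f + t * v g) \<and>
        v (\<lambda>x. f x * g x) = f p * v g + g p * v f) \<and>
     (\<forall>f. \<not> smooth_fun A f \<longrightarrow> v f = 0)}"

definition pushforward ::
  "('f::euclidean_space, 'k) atlas \<Rightarrow> ('m \<Rightarrow> 'k) \<Rightarrow> 'm tangent \<Rightarrow> 'k tangent" where
  "pushforward B h v = (\<lambda>f. if smooth_fun B f then v (f \<circ> h) else 0)"

definition vector_field :: "('e::euclidean_space, 'm) atlas \<Rightarrow> 'm vfield \<Rightarrow> bool" where
  "vector_field A X \<longleftrightarrow> (\<forall>p\<in>points A. X p \<in> tangent_space A p) \<and>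
     (\<forall>f. smooth_fun A f \<longrightarrow> smooth_fun A (\<lambda>p. X p f))"

definition lie_bracket :: "'m vfield \<Rightarrow> 'm vfield \<Rightarrow> 'm vfield" where
  "lie_bracket X Y = (\<lambda>p f. X p (\<lambda>q. Y q f) - Y p (\<lambda>q. X q f))"

definition one_form :: "('e::euclidean_space, 'm) atlas \<Rightarrow> 'm form1 \<Rightarrow> bool" where
  "one_form A \<alpha> \<longleftrightarrow>
     (\<forall>p\<in>points A. \<forall>v\<in>tangent_space A p. \<forall>w\<in>tangent_space A p. \<forall>r t.
        \<alpha> p (\<lambda>f. r * v f + t * w f) = r * \<alpha> p v + t * \<alpha> p w) \<and>
     (\<forall>X. vector_field A X \<longrightarrow> smooth_fun A (\<lambda>p. \<alpha> p (X p)))"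

definition differential :: "('m \<Rightarrow> real) \<Rightarrow> 'm form1" where
  "differential f = (\<lambda>p v. v f)"

definition pullback ::
  "('f::euclidean_space, 'k) atlas \<Rightarrow> ('m \<Rightarrow> 'k) \<Rightarrow> 'k form1 \<Rightarrow> 'm form1" where
  "pullback B h \<alpha> = (\<lambda>p v. \<alpha> (h p) (pushforward B h v))"

definition ext_deriv :: "'m form1 \<Rightarrow> 'm vfield \<Rightarrow> 'm vfield \<Rightarrow> 'm \<Rightarrow> real" where
  "ext_deriv \<alpha> X Y p =
     X p (\<lambda>q. \<alpha> q (Y q)) - Y p (\<lambda>q. \<alpha> q (X q)) - \<alpha> p (lie_bracket X Y p)"

definition tensor_prod :: "'m vfield \<Rightarrow> 'm vfield \<Rightarrow> 'm \<Rightarrow> 'm form1 \<Rightarrow> 'm form1 \<Rightarrow> real" where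
  "tensor_prod U V p \<alpha> \<gamma> = \<alpha> p (U p) * \<gamma> p (V p)"

definition is_basis :: "'m tangent set \<Rightarrow> ('k::finite \<Rightarrow> 'm tangent) \<Rightarrow> bool" where
  "is_basis V e \<longleftrightarrow> range e \<subseteq> V \<and>
     (\<forall>v\<in>V. \<exists>!r :: 'k \<Rightarrow> real. v = (\<lambda>f. \<Sum>i\<in>UNIV. r i * e i f))"

definition frame :: "('e::euclidean_space, 'm) atlas \<Rightarrow> ('k::finite \<Rightarrow> 'm vfield) \<Rightarrow> bool" where
  "frame A X \<longleftrightarrow> (\<forall>i. vector_field A (X i)) \<and>
     (\<forall>p\<in>points A. is_basis (tangent_space A p) (\<lambda>i. X i p))"

definition dual_frame ::
  "('e::euclidean_space, 'm) atlas \<Rightarrow> ('k::finite \<Rightarrow> 'm vfield) \<Rightarrow> ('k \<Rightarrow> 'm form1) \<Rightarrow> bool" where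
  "dual_frame A X \<alpha> \<longleftrightarrow> frame A X \<and>
     (\<forall>p\<in>points A. \<forall>i j. \<alpha> i p (X j p) = (if i = j then 1 else 0))"

text \<open>Concatenation \<open>(x\<^sub>1, \<dots>, x\<^sub>n, y\<^sub>1, \<dots>, y\<^sub>n, z)\<close> of two \<open>n\<close>-tuples and one further entry.\<close>

definition join :: "('n \<Rightarrow> 'c) \<Rightarrow> ('n \<Rightarrow> 'c) \<Rightarrow> 'c \<Rightarrow> 'n + 'n + unit \<Rightarrow> 'c" where
  "join x y z = case_sum x (case_sum y (\<lambda>_. z))"

definition left_invariant ::
  "('q, 'z) monoid_scheme \<Rightarrow> ('e::euclidean_space, 'q) atlas \<Rightarrow> 'q vfield \<Rightarrow> bool" where
  "left_invariant G A X \<longleftrightarrow>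
     (\<forall>g\<in>carrier G. \<forall>q\<in>carrier G. pushforward A (\<lambda>x. g \<otimes>\<^bsub>G\<^esub> x) (X q) = X (g \<otimes>\<^bsub>G\<^esub> q))"

definition integral_curve ::
  "('e::euclidean_space, 'm) atlas \<Rightarrow> 'm vfield \<Rightarrow> real set \<Rightarrow> (real \<Rightarrow> 'm) \<Rightarrow> bool" where
  "integral_curve A X J c \<longleftrightarrow> is_interval J \<and> c ` J \<subseteq> points A \<and>
     (\<forall>t\<in>J. \<forall>f. smooth_fun A f \<longrightarrow>
        ((\<lambda>u. f (c u)) has_real_derivative X (c t) f) (at t within J))"

section \<open>The extended tangent bundle \<open>TQ \<times> [a,b]\<close>\<close>

text \<open>\<open>chart_vector A \<psi> x w\<close> is the tangent vector at \<open>\<psi> x\<close> with components \<open>w\<close> in the chart inverse to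
  \<open>\<psi>\<close>. Since each tangent space consists of exactly these vectors, the points of \<open>tangent_atlas A\<close>
  are all pairs \<open>(q, X)\<close> with \<open>X \<in> tangent_space A q\<close>.\<close>

definition chart_vector ::
  "('e::euclidean_space, 'm) atlas \<Rightarrow> ('e \<Rightarrow> 'm) \<Rightarrow> 'e \<Rightarrow> 'e \<Rightarrow> 'm tangent" where
  "chart_vector A \<psi> x w =
     (\<lambda>f. if smooth_fun A f then frechet_derivative (f \<circ> \<psi>) (at x) w else 0)"

definition tangent_atlas :: "('e::euclidean_space, 'm) atlas \<Rightarrow> ('e \<times> 'e, 'm \<times> 'm tangent) atlas" where
  "tangent_atlas A = (\<lambda>(S, \<psi>). (S \<times> UNIV, \<lambda>(x, w). (\<psi> x, chart_vector A \<psi> x w))) ` A"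

type_synonym 'q ext_point = "('q \<times> 'q tangent) \<times> real"

definition extended_tangent_atlas ::
  "('e::euclidean_space, 'm) atlas \<Rightarrow> real \<Rightarrow> real \<Rightarrow>
   (('e \<times> 'e) \<times> real, 'm ext_point) atlas" where
  "extended_tangent_atlas A a b = prod_atlas (tangent_atlas A) {({a..b}, \<lambda>s. s)}"

definition base_pt :: "'q ext_point \<Rightarrow> 'q" where
  "base_pt = (\<lambda>((q, X), s). q)"

definition s_coord :: "'q ext_point \<Rightarrow> real" where
  "s_coord = (\<lambda>((q, X), s). s)"

definition fibre_coord :: "'q form1 \<Rightarrow> 'q ext_point \<Rightarrow> real" where
  "fibre_coord \<beta> = (\<lambda>((q, X), s). \<beta> q X)"

section \<open>Poisson brackets\<close>

definition poisson_bracket ::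
  "('e::euclidean_space, 'm) atlas \<Rightarrow> (('m \<Rightarrow> real) \<Rightarrow> ('m \<Rightarrow> real) \<Rightarrow> 'm \<Rightarrow> real) \<Rightarrow> bool" where
  "poisson_bracket A br \<longleftrightarrow>
     (\<forall>F G K. smooth_fun A F \<longrightarrow> smooth_fun A G \<longrightarrow> smooth_fun A K \<longrightarrow>
        smooth_fun A (br F G) \<and>
        (\<forall>m\<in>points A.
           (\<forall>r t. br (\<lambda>x. r * F x + t * G x) K m = r * br F K m + t * br G K m) \<and>
           (\<forall>r t. br K (\<lambda>x. r * F x + t * G x) m = r * br K F m + t * br K G m) \<and>
           br F G m = - br G F m \<and>
           br (\<lambda>x. F x * G x) K m = F m * br G K m + G m * br F K m \<and>
           br K (\<lambda>x. F x * G x) m = F m * br K G m + G m * br K F m \<and>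
           br F (br G K) m + br G (br K F) m + br K (br F G) m = 0))"

end

theory Submission
  imports Defs
begin

text \<open>
  Let \<open>\<Theta>\<^sub>0 = p\<^sub>i \<theta>\<^sup>i\<close>. The Maurer--Cartan equation \<open>d\<theta>\<^sup>k = - \<Sum>\<^bsub>i,j\<^esub> c\<^sup>k\<^sub>i\<^sub>j \<theta>\<^sup>i \<otimes> \<theta>\<^sup>j\<close> shows that the field
  \<open>V\<^sub>F = {-, F}\<close> satisfies \<open>d\<Theta>\<^sub>0(V\<^sub>F, W) = ds(W) D\<^sub>s(F) - W(F)\<close> for every field \<open>W\<close>. As \<open>ds(V\<^sub>F) = 0\<close>, this
  gives \<open>{F, G} = - d\<Theta>\<^sub>0(V\<^sub>F, V\<^sub>G)\<close>, so antisymmetry is that of \<open>d\<Theta>\<^sub>0\<close> and the Jacobi identity is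
  \<open>d(d\<Theta>\<^sub>0)(V\<^sub>F, V\<^sub>G, V\<^sub>K) = 0\<close>. The evolution equation is \<open>d\<Theta>(X, W) = 0\<close> for the single field
  \<open>W = V\<^sub>\<phi>\<close>. Since a tangent vector is \<open>0\<close> on non-smooth functions, the functions \<open>\<theta>\<^sup>i(X)\<close> have to be
  shown smooth for every smooth field \<open>X\<close>.
\<close>

section \<open>Smooth functions\<close>

lemma Ck_on_cong:
  assumes "open U" "\<And>x. x \<in> U \<Longrightarrow> f x = g x" "Ck_on k U f"
  shows "Ck_on k U g"
  using assms(2,3)
proof (induction k arbitrary: f g)
  case 0
  then show ?case by (simp cong: continuous_on_cong)
next
  case (Suc k)
  have der: "(g has_derivative frechet_derivative f (at x)) (at x)" if "x \<in> U" for x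
    using Suc.prems that assms(1) frechet_derivative_works has_derivative_transform_within_open
    by (metis Ck_on.simps(2))
  then have "frechet_derivative g (at x) = frechet_derivative f (at x)" if "x \<in> U" for x
    using that frechet_derivative_at by metis
  then have "Ck_on k U (\<lambda>x. frechet_derivative g (at x) v)" for v
    using Suc.IH[of "\<lambda>x. frechet_derivative f (at x) v" "\<lambda>x. frechet_derivative g (at x) v"]
      Suc.prems(2) by simp
  then show ?case using der unfolding Ck_on.simps differentiable_def by blast
qed

lemma Ck_on_subset: "Ck_on k U f \<Longrightarrow> V \<subseteq> U \<Longrightarrow> Ck_on k V f"
proof (induction k arbitrary: f)
  case 0
  then show ?case by (auto intro: continuous_on_subset)
next
  case (Suc k)
  then show ?case unfolding Ck_on.simps by blast
qed

text \<open>The product and reciprocal rules leave undifferentiated factors in the derivative; these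
  are needed at the lower order.\<close>

lemma Ck_on_SucD: "Ck_on (Suc k) U f \<Longrightarrow> Ck_on k U f"
proof (induction k arbitrary: f)
  case 0
  then show ?case
    by (simp add: continuous_at_imp_continuous_on differentiable_imp_continuous_within)
next
  case (Suc k)
  then show ?case unfolding Ck_on.simps(2)[of "Suc k"] unfolding Ck_on.simps(2)[of k] by blast
qed

text \<open>Derivatives are unique, so any explicit formula \<open>f'\<close> may replace the choice
  made by \<open>frechet_derivative\<close>.\<close>

lemma Ck_on_SucI:
  assumes "open U"
    and "\<And>x. x \<in> U \<Longrightarrow> (f has_derivative f' x) (at x)"
    and "\<And>v. Ck_on k U (\<lambda>x. f' x v)"
  shows "Ck_on (Suc k) U f"
proof -
  have "frechet_derivative f (at x) = f' x" if "x \<in> U" for x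
    using assms(2)[OF that] frechet_derivative_at by metis
  then have "Ck_on k U (\<lambda>x. frechet_derivative f (at x) v)" for v
    using Ck_on_cong[OF assms(1) _ assms(3), of v "\<lambda>x. frechet_derivative f (at x) v"] by simp
  then show ?thesis using assms(2) unfolding Ck_on.simps differentiable_def by blast
qed

lemma Ck_on_has_derivative:
  "Ck_on (Suc k) U f \<Longrightarrow> x \<in> U \<Longrightarrow> (f has_derivative frechet_derivative f (at x)) (at x)"
  unfolding Ck_on.simps using frechet_derivative_works by blast

lemma Ck_on_const: "Ck_on k U (\<lambda>x. c)"
  by (induction k arbitrary: c) (auto simp: frechet_derivative_const)

lemma Ck_on_add:
  assumes "open U" "Ck_on k U f" "Ck_on k U g"
  shows "Ck_on k U (\<lambda>x. f x + g x)"
  using assms(2,3)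
proof (induction k arbitrary: f g)
  case 0
  then show ?case by (auto intro: continuous_intros)
next
  case (Suc k)
  show ?case
    by (rule Ck_on_SucI[OF assms(1) has_derivative_add[OF Ck_on_has_derivative[OF Suc.prems(1)]
      Ck_on_has_derivative[OF Suc.prems(2)]]]) (use Suc in auto)
qed

lemma Ck_on_mult:
  fixes f g :: "'a::euclidean_space \<Rightarrow> real"
  assumes "open U" "Ck_on k U f" "Ck_on k U g"
  shows "Ck_on k U (\<lambda>x. f x * g x)"
  using assms(2,3)
proof (induction k arbitrary: f g)
  case 0
  then show ?case by (auto intro: continuous_intros)
next
  case (Suc k)
  note SucD = Suc.prems[THEN Ck_on_SucD]
  show ?case
    by (rule Ck_on_SucI[OF assms(1) has_derivative_mult[OF Ck_on_has_derivative[OF Suc.prems(1)]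
      Ck_on_has_derivative[OF Suc.prems(2)]]])
      (use Suc SucD in \<open>auto intro!: Ck_on_add assms(1)\<close>)
qed

text \<open>The derivative of \<open>1/f\<close> contains \<open>1/f\<close> again, but one order
  lower, where the induction hypothesis supplies it.\<close>

lemma Ck_on_inverse:
  fixes f :: "'a::euclidean_space \<Rightarrow> real"
  assumes "open U" "\<And>x. x \<in> U \<Longrightarrow> f x \<noteq> 0" "Ck_on k U f"
  shows "Ck_on k U (\<lambda>x. inverse (f x))"
  using assms(3)
proof (induction k)
  case 0
  then show ?case using assms(2) by (auto intro!: continuous_intros)
next
  case (Suc k)
  have inv: "Ck_on k U (\<lambda>x. inverse (f x))" using Suc Ck_on_SucD by blast
  have "Ck_on k U (\<lambda>x. - 1 * (inverse (f x) * frechet_derivative f (at x) v * inverse (f x)))" for v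
    using Suc.prems inv by (intro Ck_on_mult Ck_on_const assms(1)) auto
  then show ?case
    by (intro Ck_on_SucI[OF assms(1)
          Deriv.has_derivative_inverse[OF assms(2) Ck_on_has_derivative[OF Suc.prems]]]) auto
qed

text \<open>By the chain rule the derivative in direction \<open>v\<close> is the derivative of
  \<open>f\<close> in the fixed direction \<open>h v\<close>, composed with \<open>h\<close>, so the
  induction closes without product terms.\<close>

lemma Ck_on_compose_linear:
  fixes h :: "'a::euclidean_space \<Rightarrow> 'b::euclidean_space"
  assumes "bounded_linear h" "open U" "Ck_on k U f"
  shows "Ck_on k (h -` U) (f \<circ> h)"
  using assms(3)
proof (induction k arbitrary: f)
  case 0
  have "continuous_on (h -` U) h"
    using assms(1) by (simp add: linear_continuous_on)
  then show ?case
    using 0 by (auto simp: o_def intro: continuous_on_compose2)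
next
  case (Suc k)
  have op: "open (h -` U)"
    using assms(1,2) by (metis continuous_open_vimage linear_continuous_at)
  have "((f \<circ> h) has_derivative (\<lambda>v. frechet_derivative f (at (h x)) (h v))) (at x)"
    if "x \<in> h -` U" for x
    using diff_chain_at[OF bounded_linear.has_derivative[OF assms(1) has_derivative_ident]
        Ck_on_has_derivative[OF Suc.prems]] that
    by (auto simp: o_def)
  moreover have "Ck_on k (h -` U) (\<lambda>x. frechet_derivative f (at (h x)) (h v))" for v
    using Suc.IH[of "\<lambda>y. frechet_derivative f (at y) (h v)"] Suc.prems by (simp add: o_def)
  ultimately show ?case by (rule Ck_on_SucI[OF op])
qed

section \<open>Smoothness on arbitrary sets by local extension\<close>

lemma smooth_onE:
  assumes "smooth_on S f" "x \<in> S"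
  obtains U g where "open U" "x \<in> U" "\<And>k. Ck_on k U g" "\<And>y. y \<in> S \<Longrightarrow> y \<in> U \<Longrightarrow> g y = f y"
proof -
  obtain U g where "open U \<and> x \<in> U \<and> (\<forall>k. Ck_on k U g) \<and> (\<forall>y\<in>S \<inter> U. g y = f y)"
    using assms unfolding smooth_on_def by blast
  then show ?thesis using that[of U g] by simp
qed

lemma smooth_on_const: "smooth_on S (\<lambda>x. c)"
  unfolding smooth_on_def using Ck_on_const[of _ UNIV c] by blast

lemma smooth_on_cong: "smooth_on S f \<Longrightarrow> (\<And>x. x \<in> S \<Longrightarrow> f x = g x) \<Longrightarrow> smooth_on S g"
  unfolding smooth_on_def by simp

text \<open>The two local extensions are combined on the intersection of their
  neighbourhoods.\<close>

lemma smooth_on_binary: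
  fixes h :: "'b::real_normed_vector \<Rightarrow> 'c::real_normed_vector \<Rightarrow> 'd::real_normed_vector"
    and f :: "'a::euclidean_space \<Rightarrow> 'b" and g :: "'a \<Rightarrow> 'c"
  assumes op: "\<And>k U (f :: 'a \<Rightarrow> 'b) (g :: 'a \<Rightarrow> 'c). open U \<Longrightarrow> Ck_on k U f \<Longrightarrow> Ck_on k U g \<Longrightarrow> Ck_on k U (\<lambda>x. h (f x) (g x))"
    and "smooth_on S f" "smooth_on S g"
  shows "smooth_on S (\<lambda>x. h (f x) (g x))"
  unfolding smooth_on_def
proof
  fix x assume x: "x \<in> S"
  obtain U f' where U: "open U" "x \<in> U" "\<And>k. Ck_on k U f'" "\<And>y. y \<in> S \<Longrightarrow> y \<in> U \<Longrightarrow> f' y = f y"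
    using smooth_onE[OF assms(2) x] by metis
  obtain V g' where V: "open V" "x \<in> V" "\<And>k. Ck_on k V g'" "\<And>y. y \<in> S \<Longrightarrow> y \<in> V \<Longrightarrow> g' y = g y"
    using smooth_onE[OF assms(3) x] by metis
  have "Ck_on k (U \<inter> V) (\<lambda>x. h (f' x) (g' x))" for k
    using U(1) V(1) Ck_on_subset[OF U(3), of "U \<inter> V"] Ck_on_subset[OF V(3), of "U \<inter> V"]
    by (intro op) auto
  then show "\<exists>U f'. open U \<and> x \<in> U \<and> (\<forall>k. Ck_on k U f') \<and> (\<forall>y\<in>S \<inter> U. f' y = h (f y) (g y))"
    using U V by (intro exI[of _ "U \<inter> V"] exI[of _ "\<lambda>x. h (f' x) (g' x)"]) auto
qed

lemma smooth_on_add: "smooth_on S f \<Longrightarrow> smooth_on S g \<Longrightarrow> smooth_on S (\<lambda>x. f x + g x)"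
  by (erule smooth_on_binary[rotated]) (auto intro: Ck_on_add)

lemma smooth_on_mult:
  fixes f g :: "'a::euclidean_space \<Rightarrow> real"
  shows "smooth_on S f \<Longrightarrow> smooth_on S g \<Longrightarrow> smooth_on S (\<lambda>x. f x * g x)"
  by (erule smooth_on_binary[rotated]) (auto intro: Ck_on_mult)

lemma smooth_on_compose_linear:
  fixes h :: "'a::euclidean_space \<Rightarrow> 'b::euclidean_space"
  assumes "bounded_linear h" "smooth_on S f" "h ` R \<subseteq> S"
  shows "smooth_on R (f \<circ> h)"
  unfolding smooth_on_def
proof
  fix x assume x: "x \<in> R"
  then have "h x \<in> S" using assms by auto
  then obtain U g where U: "open U" "h x \<in> U" "\<And>k. Ck_on k U g"
      "\<And>y. y \<in> S \<Longrightarrow> y \<in> U \<Longrightarrow> g y = f y"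
    using smooth_onE[OF assms(2)] by metis
  have "open (h -` U)"
    using assms(1) U(1) by (metis continuous_open_vimage linear_continuous_at)
  then show "\<exists>U g. open U \<and> x \<in> U \<and> (\<forall>k. Ck_on k U g) \<and> (\<forall>y\<in>R \<inter> U. g y = (f \<circ> h) y)"
    using U assms(3) Ck_on_compose_linear[OF assms(1) U(1) U(3)]
    by (intro exI[of _ "h -` U"] exI[of _ "g \<circ> h"]) auto
qed

text \<open>Shaped for Cramer's rule, where \<open>n\<close> and \<open>d\<close> change with
  \<open>x\<close>. The quotient has to be extended off \<open>S\<close>, so the extension of
  \<open>d\<close> must be nonzero near \<open>x\<close>; its continuity ensures this.\<close>

lemma smooth_on_divide_locally:
  fixes f :: "'a::euclidean_space \<Rightarrow> real"
  assumes "\<And>x. x \<in> S \<Longrightarrow> \<exists>n d. smooth_on S n \<and> smooth_on S d \<and> d x \<noteq> 0 \<and>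
             (\<forall>y\<in>S. d y \<noteq> 0 \<longrightarrow> f y = n y / d y)"
  shows "smooth_on S f"
  unfolding smooth_on_def
proof
  fix x assume x: "x \<in> S"
  obtain n d where nd: "smooth_on S n" "smooth_on S d" "d x \<noteq> 0"
      and f: "\<And>y. y \<in> S \<Longrightarrow> d y \<noteq> 0 \<Longrightarrow> f y = n y / d y"
    using assms[OF x] by blast
  obtain U n' where U: "open U" "x \<in> U" "\<And>k. Ck_on k U n'" "\<And>y. y \<in> S \<Longrightarrow> y \<in> U \<Longrightarrow> n' y = n y"
    using smooth_onE[OF nd(1) x] by metis
  obtain V d' where V: "open V" "x \<in> V" "\<And>k. Ck_on k V d'" "\<And>y. y \<in> S \<Longrightarrow> y \<in> V \<Longrightarrow> d' y = d y"
    using smooth_onE[OF nd(2) x] by metis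
  define W where "W = U \<inter> {y \<in> V. d' y \<noteq> 0}"
  have "continuous_on V d'" using V(3)[of 0] by simp
  then have "open {y \<in> V. d' y \<noteq> 0}"
    using continuous_open_preimage[of V d' "- {0}"] V(1)
    by (simp add: Int_def vimage_def open_Compl)
  then have W: "open W" unfolding W_def using U(1) by auto
  have "Ck_on k W (\<lambda>x. n' x * inverse (d' x))" for k
    using W U(3) V(3) by (intro Ck_on_mult Ck_on_inverse) (auto simp: W_def intro: Ck_on_subset)
  moreover have "x \<in> W" using U V nd x by (auto simp: W_def)
  ultimately show "\<exists>U g. open U \<and> x \<in> U \<and> (\<forall>k. Ck_on k U g) \<and> (\<forall>y\<in>S \<inter> U. g y = f y)"
    using W U V f by (intro exI[of _ W] exI[of _ "\<lambda>x. n' x * inverse (d' x)"])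
      (auto simp: W_def divide_inverse)
qed

section \<open>Smooth functions on an atlas\<close>

lemma in_pointsI: "(S, \<psi>) \<in> A \<Longrightarrow> x \<in> S \<Longrightarrow> \<psi> x \<in> points A"
  unfolding points_def by blast

lemma smooth_funI:
  "(\<And>S \<psi>. (S, \<psi>) \<in> A \<Longrightarrow> smooth_on S (\<lambda>x. f (\<psi> x))) \<Longrightarrow> smooth_fun A f"
  unfolding smooth_fun_def by (auto simp: o_def)

lemma smooth_funD: "smooth_fun A f \<Longrightarrow> (S, \<psi>) \<in> A \<Longrightarrow> smooth_on S (\<lambda>x. f (\<psi> x))"
  unfolding smooth_fun_def by (auto simp: o_def)

lemma smooth_fun_cong:
  assumes "smooth_fun A f" "\<And>m. m \<in> points A \<Longrightarrow> f m = g m"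
  shows "smooth_fun A g"
proof (rule smooth_funI)
  fix S \<psi> assume S: "(S, \<psi>) \<in> A"
  show "smooth_on S (\<lambda>x. g (\<psi> x))"
    by (rule smooth_on_cong[OF smooth_funD[OF assms(1) S]]) (rule assms(2)[OF in_pointsI[OF S]])
qed

lemma smooth_fun_const: "smooth_fun A (\<lambda>m. c)"
  by (rule smooth_funI) (rule smooth_on_const)

lemma smooth_fun_add: "smooth_fun A f \<Longrightarrow> smooth_fun A g \<Longrightarrow> smooth_fun A (\<lambda>m. f m + g m)"
  by (rule smooth_funI) (intro smooth_on_add smooth_funD[of A f] smooth_funD[of A g])

lemma smooth_fun_mult: "smooth_fun A f \<Longrightarrow> smooth_fun A g \<Longrightarrow> smooth_fun A (\<lambda>m. f m * g m)"
  by (rule smooth_funI) (intro smooth_on_mult smooth_funD[of A f] smooth_funD[of A g])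

lemma smooth_fun_cmult: "smooth_fun A f \<Longrightarrow> smooth_fun A (\<lambda>m. r * f m)"
  by (intro smooth_fun_mult smooth_fun_const)

lemma smooth_fun_minus: "smooth_fun A f \<Longrightarrow> smooth_fun A (\<lambda>m. - f m)"
  using smooth_fun_cmult[of A f "-1"] by simp

lemma smooth_fun_diff: "smooth_fun A f \<Longrightarrow> smooth_fun A g \<Longrightarrow> smooth_fun A (\<lambda>m. f m - g m)"
  using smooth_fun_add[OF _ smooth_fun_minus, of A f g] by simp

lemma smooth_fun_sum:
  "(\<And>i. i \<in> I \<Longrightarrow> smooth_fun A (f i)) \<Longrightarrow> smooth_fun A (\<lambda>m. \<Sum>i\<in>I. f i m)"
  by (induction I rule: infinite_finite_induct) (auto intro: smooth_fun_const smooth_fun_add)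

lemma smooth_fun_prod:
  "(\<And>i. i \<in> I \<Longrightarrow> smooth_fun A (f i)) \<Longrightarrow> smooth_fun A (\<lambda>m. \<Prod>i\<in>I. f i m)"
  by (induction I rule: infinite_finite_induct) (auto intro: smooth_fun_const smooth_fun_mult)

lemma smooth_fun_det:
  fixes a :: "'n::finite \<Rightarrow> 'n \<Rightarrow> 'm \<Rightarrow> real"
  assumes "\<And>i j. smooth_fun A (a i j)"
  shows "smooth_fun A (\<lambda>m. det (\<chi> i j. a i j m))"
  unfolding det_def vec_lambda_beta
  by (rule smooth_fun_sum, rule smooth_fun_cmult, rule smooth_fun_prod, rule assms)

text \<open>Cramer's rule writes each \<open>x k\<close> near \<open>m\<^sub>0\<close> as a quotient
  of determinants of smooth functions. The system may depend on \<open>m\<^sub>0\<close>, and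
  regularity at \<open>m\<^sub>0\<close> alone suffices.\<close>

lemma smooth_fun_solution:
  fixes x :: "'n::finite \<Rightarrow> 'm \<Rightarrow> real"
  assumes "\<And>m\<^sub>0. m\<^sub>0 \<in> points A \<Longrightarrow> \<exists>a h. (\<forall>i j. smooth_fun A (a i j)) \<and> (\<forall>i. smooth_fun A (h i)) \<and>
      det (\<chi> i j. a i j m\<^sub>0) \<noteq> 0 \<and> (\<forall>i. \<forall>m\<in>points A. (\<Sum>j\<in>UNIV. a i j m * x j m) = h i m)"
  shows "smooth_fun A (x k)"
proof (rule smooth_funI, rule smooth_on_divide_locally)
  fix S \<psi> y\<^sub>0 assume S: "(S, \<psi>) \<in> A" and y0: "y\<^sub>0 \<in> S"
  obtain a h where ah: "(\<forall>i j. smooth_fun A (a i j)) \<and> (\<forall>i. smooth_fun A (h i)) \<and>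
      det (\<chi> i j. a i j (\<psi> y\<^sub>0)) \<noteq> 0 \<and> (\<forall>i. \<forall>m\<in>points A. (\<Sum>j\<in>UNIV. a i j m * x j m) = h i m)"
    using assms[OF in_pointsI[OF S y0]] by blast
  then have a: "\<And>i j. smooth_fun A (a i j)" and h: "\<And>i. smooth_fun A (h i)"
    and det: "det (\<chi> i j. a i j (\<psi> y\<^sub>0)) \<noteq> 0"
    and eq: "\<And>i m. m \<in> points A \<Longrightarrow> (\<Sum>j\<in>UNIV. a i j m * x j m) = h i m"
    by blast+
  \<comment> \<open>The numerator in Cramer's rule: column \<open>k\<close> is replaced by the
    right-hand side.\<close>
  define n where "n = (\<lambda>m. det (\<chi> i j. (if j = k then h i else a i j) m))"
  define d where "d = (\<lambda>m. det (\<chi> i j. a i j m))"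
  have "smooth_fun A n" unfolding n_def using a h by (intro smooth_fun_det) auto
  moreover have "smooth_fun A d" unfolding d_def using a by (intro smooth_fun_det) auto
  moreover have "x k m = n m / d m" if m: "m \<in> points A" "d m \<noteq> 0" for m
  proof -
    have "(\<chi> i j. a i j m) *v (\<chi> j. x j m) = (\<chi> i. h i m)"
      using eq[OF m(1)] by (simp add: matrix_vector_mult_def vec_eq_iff)
    then have "(\<chi> j. x j m) $ k = n m / d m"
      using cramer[of "\<chi> i j. a i j m"] m(2) unfolding d_def n_def
      by (simp add: if_distrib[of "\<lambda>f. f m"] cong: if_cong)
    then show ?thesis by simp
  qed
  ultimately have "smooth_on S (\<lambda>y. n (\<psi> y)) \<and> smooth_on S (\<lambda>y. d (\<psi> y)) \<and> d (\<psi> y\<^sub>0) \<noteq> 0 \<and>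
      (\<forall>y\<in>S. d (\<psi> y) \<noteq> 0 \<longrightarrow> x k (\<psi> y) = n (\<psi> y) / d (\<psi> y))"
    using det in_pointsI[OF S] smooth_funD[of A n, OF _ S] smooth_funD[of A d, OF _ S]
    by (auto simp: d_def)
  then show "\<exists>n d. smooth_on S n \<and> smooth_on S d \<and> d y\<^sub>0 \<noteq> 0 \<and>
      (\<forall>y\<in>S. d y \<noteq> 0 \<longrightarrow> x k (\<psi> y) = n y / d y)"
    by (intro exI)
qed

section \<open>Tangent vectors and vector fields\<close>

lemma tangent_nonsmooth: "v \<in> tangent_space A m \<Longrightarrow> \<not> smooth_fun A f \<Longrightarrow> v f = 0"
  unfolding tangent_space_def by blast

lemma tangent_linear:
  "v \<in> tangent_space A m \<Longrightarrow> smooth_fun A f \<Longrightarrow> smooth_fun A g \<Longrightarrow>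
     v (\<lambda>x. r * f x + t * g x) = r * v f + t * v g"
  unfolding tangent_space_def by blast

lemma tangent_mult:
  "v \<in> tangent_space A m \<Longrightarrow> smooth_fun A f \<Longrightarrow> smooth_fun A g \<Longrightarrow>
     v (\<lambda>x. f x * g x) = f m * v g + g m * v f"
  unfolding tangent_space_def by blast

lemma tangent_spaceI:
  assumes "\<And>f g r t. smooth_fun A f \<Longrightarrow> smooth_fun A g \<Longrightarrow>
             v (\<lambda>x. r * f x + t * g x) = r * v f + t * v g"
    and "\<And>f g. smooth_fun A f \<Longrightarrow> smooth_fun A g \<Longrightarrow> v (\<lambda>x. f x * g x) = f m * v g + g m * v f"
    and "\<And>f. \<not> smooth_fun A f \<Longrightarrow> v f = 0"
  shows "v \<in> tangent_space A m"
  unfolding tangent_space_def using assms by blast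

lemma tangent_cmult: "v \<in> tangent_space A m \<Longrightarrow> smooth_fun A f \<Longrightarrow> v (\<lambda>x. r * f x) = r * v f"
  using tangent_linear[of v A m f f r 0] by simp

lemma tangent_add:
  "v \<in> tangent_space A m \<Longrightarrow> smooth_fun A f \<Longrightarrow> smooth_fun A g \<Longrightarrow> v (\<lambda>x. f x + g x) = v f + v g"
  using tangent_linear[of v A m f g 1 1] by simp

lemma tangent_diff:
  "v \<in> tangent_space A m \<Longrightarrow> smooth_fun A f \<Longrightarrow> smooth_fun A g \<Longrightarrow> v (\<lambda>x. f x - g x) = v f - v g"
  using tangent_linear[of v A m f g 1 "-1"] by simp

text \<open>The Leibniz rule for the product of the constant 1 with itself forces \<open>v\<close>
  to vanish on 1; scaling does the rest.\<close>

lemma tangent_const: "v \<in> tangent_space A m \<Longrightarrow> v (\<lambda>x. r) = 0"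
  using tangent_mult[of v A m "\<lambda>x. 1" "\<lambda>x. 1"] tangent_cmult[of v A m "\<lambda>x. 1" r]
    smooth_fun_const[of A 1] by simp

lemma tangent_sum:
  assumes "v \<in> tangent_space A m" "\<And>i. i \<in> I \<Longrightarrow> smooth_fun A (f i)"
  shows "v (\<lambda>x. \<Sum>i\<in>I. f i x) = (\<Sum>i\<in>I. v (f i))"
  using assms(2)
proof (induction I rule: infinite_finite_induct)
  case (insert i I)
  then have "v (\<lambda>x. f i x + (\<Sum>i\<in>I. f i x)) = v (f i) + (\<Sum>i\<in>I. v (f i))"
    using tangent_add[OF assms(1), of "f i" "\<lambda>x. \<Sum>i\<in>I. f i x"] smooth_fun_sum[of I A f] by simp
  then show ?case using insert by simp
qed (auto simp: tangent_const[OF assms(1)])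

text \<open>Multiplication with the indicator \<open>\<kappa>\<close> of the complement of \<open>points A\<close>, itself a smooth function,
  fixes \<open>f - g\<close>, so the Leibniz rule at \<open>m\<close>, where both \<open>\<kappa>\<close> and \<open>f - g\<close> vanish, gives \<open>v (f - g) = 0\<close>.\<close>

lemma tangent_cong:
  assumes v: "v \<in> tangent_space A m" and m: "m \<in> points A"
    and eq: "\<And>x. x \<in> points A \<Longrightarrow> f x = g x"
  shows "v f = v g"
proof (cases "smooth_fun A f")
  case f: True
  then have g: "smooth_fun A g" using eq by (rule smooth_fun_cong)
  define \<kappa> where "\<kappa> = (\<lambda>x. if x \<in> points A then 0 else 1 :: real)"
  have \<kappa>: "smooth_fun A \<kappa>"
    by (rule smooth_fun_cong[OF smooth_fun_const[of _ 0]]) (simp add: \<kappa>_def)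
  have "(\<lambda>x. f x - g x) = (\<lambda>x. (f x - g x) * \<kappa> x)"
    using eq by (auto simp: \<kappa>_def)
  then have "v (\<lambda>x. f x - g x) = 0"
    using tangent_mult[OF v smooth_fun_diff[OF f g] \<kappa>] eq[OF m] m by (simp add: \<kappa>_def)
  then show ?thesis using tangent_diff[OF v f g] by simp
next
  case False
  then have "\<not> smooth_fun A g" using eq smooth_fun_cong[of A g f] by auto
  then show ?thesis using False tangent_nonsmooth[OF v] by simp
qed

lemma tangent_space_lincomb:
  assumes "v \<in> tangent_space A m" "w \<in> tangent_space A m"
  shows "(\<lambda>f. r * v f + t * w f) \<in> tangent_space A m"
  by (rule tangent_spaceI)
    (simp_all add: assms[THEN tangent_linear] assms[THEN tangent_mult] assms[THEN tangent_nonsmooth]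
      algebra_simps)

lemma tangent_space_zero: "(\<lambda>f. 0) \<in> tangent_space A m"
  by (rule tangent_spaceI) auto

lemma tangent_space_sum:
  "(\<And>i. i \<in> I \<Longrightarrow> e i \<in> tangent_space A m) \<Longrightarrow> (\<lambda>f. \<Sum>i\<in>I. r i * e i f) \<in> tangent_space A m"
proof (induction I rule: infinite_finite_induct)
  case (insert i I)
  then show ?case
    using tangent_space_lincomb[of "e i" A m "\<lambda>f. \<Sum>i\<in>I. r i * e i f" "r i" 1] by simp
qed (auto intro: tangent_space_zero)

section \<open>Vector fields and their Lie bracket\<close>

lemma vector_field_tangent: "vector_field A X \<Longrightarrow> m \<in> points A \<Longrightarrow> X m \<in> tangent_space A m"
  unfolding vector_field_def by blast

lemma vector_field_smooth: "vector_field A X \<Longrightarrow> smooth_fun A f \<Longrightarrow> smooth_fun A (\<lambda>m. X m f)"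
  unfolding vector_field_def by blast

lemma vector_field_lincomb:
  assumes "\<And>i. i \<in> I \<Longrightarrow> vector_field A (X i)" "\<And>i. i \<in> I \<Longrightarrow> smooth_fun A (u i)"
  shows "vector_field A (\<lambda>m f. \<Sum>i\<in>I. u i m * X i m f)"
  unfolding vector_field_def
proof (intro conjI ballI allI impI)
  fix m assume "m \<in> points A"
  then show "(\<lambda>f. \<Sum>i\<in>I. u i m * X i m f) \<in> tangent_space A m"
    using assms(1) by (intro tangent_space_sum vector_field_tangent)
next
  fix f assume f: "smooth_fun A f"
  have "smooth_fun A (\<lambda>m. u i m * X i m f)" if "i \<in> I" for i
    by (rule smooth_fun_mult[OF assms(2)[OF that] vector_field_smooth[OF assms(1)[OF that] f]])
  then show "smooth_fun A (\<lambda>m. \<Sum>i\<in>I. u i m * X i m f)"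
    by (rule smooth_fun_sum)
qed

lemma vector_field_add:
  assumes "vector_field A X" "vector_field A Y"
  shows "vector_field A (\<lambda>m f. X m f + Y m f)"
proof -
  \<comment> \<open>The sum is a linear combination over the index set \<open>bool\<close> with all
    coefficients 1.\<close>
  have "vector_field A (if b then X else Y)" for b using assms by simp
  from vector_field_lincomb[of UNIV A "\<lambda>b. if b then X else Y" "\<lambda>_ _. 1", OF this smooth_fun_const]
  show ?thesis by (simp add: UNIV_bool add.commute)
qed

lemma vector_field_lie_bracket:
  assumes X: "vector_field A X" and Y: "vector_field A Y"
  shows "vector_field A (lie_bracket X Y)"
  unfolding vector_field_def
proof (intro conjI ballI allI impI)
  fix f assume f: "smooth_fun A f"
  show "smooth_fun A (\<lambda>m. lie_bracket X Y m f)"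
    unfolding lie_bracket_def
    by (intro smooth_fun_diff vector_field_smooth[OF X vector_field_smooth[OF Y f]]
        vector_field_smooth[OF Y vector_field_smooth[OF X f]])
next
  fix m assume m: "m \<in> points A"
  note Xm = vector_field_tangent[OF X m] and Ym = vector_field_tangent[OF Y m]
  show "lie_bracket X Y m \<in> tangent_space A m"
  proof (rule tangent_spaceI)
    fix f g r t
    assume f: "smooth_fun A f" and g: "smooth_fun A g"
    have lin: "V m (\<lambda>q. W q (\<lambda>x. r * f x + t * g x)) = r * V m (\<lambda>q. W q f) + t * V m (\<lambda>q. W q g)"
      if V: "vector_field A V" and W: "vector_field A W" for V W
    proof -
      \<comment> \<open>\<open>W q\<close> is a derivation only for \<open>q\<close> in
        \<open>points A\<close>, so rewriting below \<open>V m\<close> has to go through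
        \<open>tangent_cong\<close>.\<close>
      have "V m (\<lambda>q. W q (\<lambda>x. r * f x + t * g x)) = V m (\<lambda>q. r * W q f + t * W q g)"
        by (rule tangent_cong[OF vector_field_tangent[OF V m] m])
          (rule tangent_linear[OF vector_field_tangent[OF W] f g])
      then show ?thesis
        using tangent_linear[OF vector_field_tangent[OF V m] vector_field_smooth[OF W f]
            vector_field_smooth[OF W g]] by simp
    qed
    show "lie_bracket X Y m (\<lambda>x. r * f x + t * g x) = r * lie_bracket X Y m f + t * lie_bracket X Y m g"
      unfolding lie_bracket_def lin[OF X Y] lin[OF Y X] by (simp add: algebra_simps)
    \<comment> \<open>The cross terms \<open>W m g * V m f + W m f * V m g\<close> are symmetric in
      \<open>V\<close> and \<open>W\<close> and cancel in the commutator.\<close>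
    have leib: "V m (\<lambda>q. W q (\<lambda>x. f x * g x)) =
        f m * V m (\<lambda>q. W q g) + W m g * V m f + g m * V m (\<lambda>q. W q f) + W m f * V m g"
      if V: "vector_field A V" and W: "vector_field A W" for V W
    proof -
      note Vm = vector_field_tangent[OF V m]
        and Wf = vector_field_smooth[OF W f] and Wg = vector_field_smooth[OF W g]
      have "V m (\<lambda>q. W q (\<lambda>x. f x * g x)) = V m (\<lambda>q. f q * W q g + g q * W q f)"
        by (rule tangent_cong[OF Vm m]) (rule tangent_mult[OF vector_field_tangent[OF W] f g])
      also have "\<dots> = V m (\<lambda>q. f q * W q g) + V m (\<lambda>q. g q * W q f)"
        by (rule tangent_add[OF Vm smooth_fun_mult[OF f Wg] smooth_fun_mult[OF g Wf]])
      finally show ?thesis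
        unfolding tangent_mult[OF Vm f Wg] tangent_mult[OF Vm g Wf] by simp
    qed
    show "lie_bracket X Y m (\<lambda>x. f x * g x) = f m * lie_bracket X Y m g + g m * lie_bracket X Y m f"
      unfolding lie_bracket_def leib[OF X Y] leib[OF Y X] by (simp add: algebra_simps)
  next
    fix f assume f: "\<not> smooth_fun A f"
    have zero: "V m (\<lambda>q. W q f) = 0" if V: "vector_field A V" and W: "vector_field A W" for V W
    proof -
      have "V m (\<lambda>q. W q f) = V m (\<lambda>q. 0)"
        by (rule tangent_cong[OF vector_field_tangent[OF V m] m])
          (rule tangent_nonsmooth[OF vector_field_tangent[OF W] f])
      then show ?thesis using tangent_const[OF vector_field_tangent[OF V m]] by simp
    qed
    show "lie_bracket X Y m f = 0" unfolding lie_bracket_def zero[OF X Y] zero[OF Y X] by simp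
  qed
qed

text \<open>On a smooth \<open>f\<close> the twelve triple derivatives cancel in pairs. On any other
  \<open>f\<close> each iterated bracket is 0, being a tangent vector.\<close>

lemma lie_bracket_jacobi:
  assumes X: "vector_field A X" and Y: "vector_field A Y" and Z: "vector_field A Z"
    and m: "m \<in> points A"
  shows "lie_bracket (lie_bracket X Y) Z m f + lie_bracket (lie_bracket Y Z) X m f
    + lie_bracket (lie_bracket Z X) Y m f = 0"
proof (cases "smooth_fun A f")
  case f: True
  have "lie_bracket (lie_bracket U V) W m f = U m (\<lambda>q. V q (\<lambda>q. W q f)) - V m (\<lambda>q. U q (\<lambda>q. W q f))
      - (W m (\<lambda>q. U q (\<lambda>q. V q f)) - W m (\<lambda>q. V q (\<lambda>q. U q f)))"
    if U: "vector_field A U" and V: "vector_field A V" and W: "vector_field A W" for U V W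
    using tangent_diff[OF vector_field_tangent[OF W m]
        vector_field_smooth[OF U vector_field_smooth[OF V f]]
        vector_field_smooth[OF V vector_field_smooth[OF U f]]]
    by (simp add: lie_bracket_def)
  from this[OF X Y Z] this[OF Y Z X] this[OF Z X Y] show ?thesis by simp
next
  case False
  then have "lie_bracket (lie_bracket U V) W m f = 0"
    if "vector_field A U" "vector_field A V" "vector_field A W" for U V W
    using that by (intro tangent_nonsmooth[OF vector_field_tangent[OF _ m]] vector_field_lie_bracket)
  then show ?thesis using X Y Z by simp
qed

section \<open>One-forms\<close>

lemma one_form_linear:
  "one_form A \<alpha> \<Longrightarrow> m \<in> points A \<Longrightarrow> v \<in> tangent_space A m \<Longrightarrow> w \<in> tangent_space A m \<Longrightarrow>
     \<alpha> m (\<lambda>f. r * v f + t * w f) = r * \<alpha> m v + t * \<alpha> m w"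
  unfolding one_form_def by blast

lemma one_form_smooth: "one_form A \<alpha> \<Longrightarrow> vector_field A X \<Longrightarrow> smooth_fun A (\<lambda>m. \<alpha> m (X m))"
  unfolding one_form_def by blast

lemma one_form_zero: "one_form A \<alpha> \<Longrightarrow> m \<in> points A \<Longrightarrow> \<alpha> m (\<lambda>f. 0) = 0"
  using one_form_linear[of A \<alpha> m "\<lambda>f. 0" "\<lambda>f. 0" 0 0] tangent_space_zero[of A m] by simp

lemma one_form_add:
  "one_form A \<alpha> \<Longrightarrow> m \<in> points A \<Longrightarrow> v \<in> tangent_space A m \<Longrightarrow> w \<in> tangent_space A m \<Longrightarrow>
     \<alpha> m (\<lambda>f. v f + w f) = \<alpha> m v + \<alpha> m w"
  using one_form_linear[of A \<alpha> m v w 1 1] by simp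

lemma one_form_sum:
  assumes "one_form A \<alpha>" "m \<in> points A" "\<And>i. i \<in> I \<Longrightarrow> e i \<in> tangent_space A m"
  shows "\<alpha> m (\<lambda>f. \<Sum>i\<in>I. r i * e i f) = (\<Sum>i\<in>I. r i * \<alpha> m (e i))"
  using assms(3)
proof (induction I rule: infinite_finite_induct)
  case (insert i I)
  then show ?case
    using one_form_linear[OF assms(1,2), of "e i" "\<lambda>f. \<Sum>i\<in>I. r i * e i f" "r i" 1]
      tangent_space_sum[of I e A m r] by simp
qed (auto simp: one_form_zero[OF assms(1,2)])

lemma one_form_differential:
  assumes "smooth_fun A f"
  shows "one_form A (differential f)"
  unfolding one_form_def differential_def using vector_field_smooth assms by blast

lemma one_form_combination:
  assumes "\<And>i. i \<in> I \<Longrightarrow> one_form A (\<alpha> i)" "\<And>i. i \<in> I \<Longrightarrow> smooth_fun A (u i)"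
  shows "one_form A (\<lambda>m v. \<Sum>i\<in>I. u i m * \<alpha> i m v)"
  unfolding one_form_def
proof (intro conjI ballI allI impI)
  fix m v w r t assume "m \<in> points A" "v \<in> tangent_space A m" "w \<in> tangent_space A m"
  then have "(\<Sum>i\<in>I. u i m * \<alpha> i m (\<lambda>f. r * v f + t * w f)) =
      (\<Sum>i\<in>I. u i m * (r * \<alpha> i m v + t * \<alpha> i m w))"
    by (intro sum.cong) (simp_all add: one_form_linear[OF assms(1)])
  then show "(\<Sum>i\<in>I. u i m * \<alpha> i m (\<lambda>f. r * v f + t * w f)) =
      r * (\<Sum>i\<in>I. u i m * \<alpha> i m v) + t * (\<Sum>i\<in>I. u i m * \<alpha> i m w)"
    by (simp add: sum_distrib_left sum.distrib algebra_simps)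
next
  fix X assume X: "vector_field A X"
  have "smooth_fun A (\<lambda>m. u i m * \<alpha> i m (X m))" if "i \<in> I" for i
    by (rule smooth_fun_mult[OF assms(2)[OF that] one_form_smooth[OF assms(1)[OF that] X]])
  then show "smooth_fun A (\<lambda>m. \<Sum>i\<in>I. u i m * \<alpha> i m (X m))"
    by (rule smooth_fun_sum)
qed

section \<open>The exterior derivative\<close>

lemma ext_deriv_antisym:
  assumes "one_form A \<alpha>" "vector_field A X" "vector_field A Y" "m \<in> points A"
  shows "ext_deriv \<alpha> X Y m = - ext_deriv \<alpha> Y X m"
proof -
  \<comment> \<open>The negative is written as a linear combination so that
    \<open>one_form_linear\<close> applies.\<close>
  have "lie_bracket Y X m = (\<lambda>f. - 1 * lie_bracket X Y m f + 0 * lie_bracket X Y m f)"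
    by (simp add: lie_bracket_def)
  then have "\<alpha> m (lie_bracket Y X m) = - \<alpha> m (lie_bracket X Y m)"
    using one_form_linear[OF assms(1,4), of "lie_bracket X Y m" "lie_bracket X Y m" "-1" 0]
      vector_field_tangent[OF vector_field_lie_bracket[OF assms(2,3)] assms(4)] by simp
  then show ?thesis by (simp add: ext_deriv_def)
qed

text \<open>This is \<open>d\<^sup>2 = 0\<close>, with the exterior derivative of a 2-form written out.\<close>

lemma ext_deriv_closed:
  assumes \<alpha>: "one_form A \<alpha>" and X: "vector_field A X" and Y: "vector_field A Y"
    and Z: "vector_field A Z" and m: "m \<in> points A"
  shows "X m (ext_deriv \<alpha> Y Z) + Y m (ext_deriv \<alpha> Z X) + Z m (ext_deriv \<alpha> X Y) =
    ext_deriv \<alpha> (lie_bracket X Y) Z m + ext_deriv \<alpha> (lie_bracket Y Z) X m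
      + ext_deriv \<alpha> (lie_bracket Z X) Y m"
proof -
  have outer: "U m (ext_deriv \<alpha> V W) = U m (\<lambda>q. V q (\<lambda>q. \<alpha> q (W q))) - U m (\<lambda>q. W q (\<lambda>q. \<alpha> q (V q)))
      - U m (\<lambda>q. \<alpha> q (lie_bracket V W q))"
    if U: "vector_field A U" and V: "vector_field A V" and W: "vector_field A W" for U V W
  proof -
    note Um = vector_field_tangent[OF U m]
      and VW = vector_field_smooth[OF V one_form_smooth[OF \<alpha> W]]
      and WV = vector_field_smooth[OF W one_form_smooth[OF \<alpha> V]]
    have "U m (ext_deriv \<alpha> V W) = U m (\<lambda>q. V q (\<lambda>q. \<alpha> q (W q)) - W q (\<lambda>q. \<alpha> q (V q))
        - \<alpha> q (lie_bracket V W q))"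
      by (simp add: ext_deriv_def[abs_def])
    then show ?thesis
      unfolding tangent_diff[OF Um smooth_fun_diff[OF VW WV]
          one_form_smooth[OF \<alpha> vector_field_lie_bracket[OF V W]]]
        tangent_diff[OF Um VW WV] .
  qed
  define jac where "jac = (\<lambda>U V W. lie_bracket (lie_bracket U V) W m)"
  have tan: "jac U V W \<in> tangent_space A m"
    if "vector_field A U" "vector_field A V" "vector_field A W" for U V W
    using that m unfolding jac_def by (intro vector_field_tangent vector_field_lie_bracket)
  \<comment> \<open>The iterated derivatives cancel by themselves; what remains is the cyclic sum of
    \<alpha> on triple brackets, which vanishes by linearity and the Jacobi identity.\<close>
  have "\<alpha> m (jac X Y Z) + \<alpha> m (jac Y Z X) + \<alpha> m (jac Z X Y) =
      \<alpha> m (\<lambda>f. jac X Y Z f + jac Y Z X f + jac Z X Y f)"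
    using one_form_add[OF \<alpha> m] tan X Y Z tangent_space_lincomb[of "jac X Y Z" A m "jac Y Z X" 1 1]
    by simp
  also have "\<dots> = 0"
    unfolding jac_def using lie_bracket_jacobi[OF X Y Z m] one_form_zero[OF \<alpha> m] by simp
  finally show ?thesis
    unfolding outer[OF X Y Z] outer[OF Y Z X] outer[OF Z X Y] jac_def
    by (simp add: ext_deriv_def lie_bracket_def)
qed

text \<open>The rule \<open>d(u \<alpha>) = du \<and> \<alpha> + u d\<alpha>\<close>, summed over
  the index set.\<close>

lemma ext_deriv_combination:
  assumes \<alpha>: "\<And>i. i \<in> I \<Longrightarrow> one_form A (\<alpha> i)" and u: "\<And>i. i \<in> I \<Longrightarrow> smooth_fun A (u i)"
    and X: "vector_field A X" and Y: "vector_field A Y" and m: "m \<in> points A"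
  shows "ext_deriv (\<lambda>m v. \<Sum>i\<in>I. u i m * \<alpha> i m v) X Y m =
    (\<Sum>i\<in>I. X m (u i) * \<alpha> i m (Y m) - Y m (u i) * \<alpha> i m (X m) + u i m * ext_deriv (\<alpha> i) X Y m)"
proof -
  have der: "V m (\<lambda>q. \<Sum>i\<in>I. u i q * \<alpha> i q (W q)) =
      (\<Sum>i\<in>I. u i m * V m (\<lambda>q. \<alpha> i q (W q)) + \<alpha> i m (W m) * V m (u i))"
    if V: "vector_field A V" and W: "vector_field A W" for V W
  proof -
    note Vm = vector_field_tangent[OF V m]
    have "V m (\<lambda>q. \<Sum>i\<in>I. u i q * \<alpha> i q (W q)) = (\<Sum>i\<in>I. V m (\<lambda>q. u i q * \<alpha> i q (W q)))"
      by (rule tangent_sum[OF Vm]) (rule smooth_fun_mult[OF u one_form_smooth[OF \<alpha> W]])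
    also have "\<dots> = (\<Sum>i\<in>I. u i m * V m (\<lambda>q. \<alpha> i q (W q)) + \<alpha> i m (W m) * V m (u i))"
      by (rule sum.cong[OF refl]) (rule tangent_mult[OF Vm u one_form_smooth[OF \<alpha> W]])
    finally show ?thesis .
  qed
  show ?thesis
    unfolding ext_deriv_def der[OF X Y] der[OF Y X]
    by (simp add: sum_subtractf[symmetric] algebra_simps)
qed

lemma ext_deriv_diff:
  assumes \<alpha>: "one_form A \<alpha>" and \<gamma>: "one_form A \<gamma>"
    and X: "vector_field A X" and Y: "vector_field A Y" and m: "m \<in> points A"
  shows "ext_deriv (\<lambda>m v. \<alpha> m v - \<gamma> m v) X Y m = ext_deriv \<alpha> X Y m - ext_deriv \<gamma> X Y m"
  unfolding ext_deriv_def
    tangent_diff[OF vector_field_tangent[OF X m] one_form_smooth[OF \<alpha> Y] one_form_smooth[OF \<gamma> Y]]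
    tangent_diff[OF vector_field_tangent[OF Y m] one_form_smooth[OF \<alpha> X] one_form_smooth[OF \<gamma> X]]
  by simp

text \<open>Here \<open>d(df) = 0\<close> is just the definition of the Lie bracket as a
  commutator.\<close>

lemma ext_deriv_differential: "ext_deriv (differential f) X Y m = 0"
  by (simp add: ext_deriv_def differential_def lie_bracket_def)

section \<open>Dual frames and expansions\<close>

lemma dual_frame_vector_field: "dual_frame A X \<alpha> \<Longrightarrow> vector_field A (X i)"
  by (simp add: dual_frame_def frame_def)

lemma dual_frame_delta:
  "dual_frame A X \<alpha> \<Longrightarrow> m \<in> points A \<Longrightarrow> \<alpha> i m (X j m) = (if i = j then 1 else 0)"
  by (simp add: dual_frame_def)

text \<open>A tangent vector is 0 on non-smooth functions, whereas duality makes
  \<open>X i m f\<close> equal to 1. If there are no points, every function is smooth.\<close>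

lemma dual_frame_differential_smooth:
  assumes "dual_frame A X \<alpha>" "\<alpha> i = differential f"
  shows "smooth_fun A f"
proof (cases "points A = {}")
  case True
  then show ?thesis using smooth_fun_cong[OF smooth_fun_const[of A 0], of f] by simp
next
  case False
  then obtain m where m: "m \<in> points A" by blast
  have "X i m f = 1"
    using dual_frame_delta[OF assms(1) m, of i i] by (simp add: assms(2) differential_def)
  then show ?thesis
    using tangent_nonsmooth[OF vector_field_tangent[OF dual_frame_vector_field[OF assms(1)] m]]
    by force
qed

text \<open>Applying \<open>\<alpha> i\<close> to the basis expansion of \<open>v\<close> identifies
  its coefficients.\<close>

lemma dual_frame_expansion:
  assumes D: "dual_frame A X \<alpha>" and \<alpha>: "\<And>i. one_form A (\<alpha> i)"
    and m: "m \<in> points A" and v: "v \<in> tangent_space A m"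
  shows "v f = (\<Sum>i\<in>UNIV. \<alpha> i m v * X i m f)"
proof -
  have "frame A X" and delta: "\<alpha> i m (X j m) = (if i = j then 1 else 0)" for i j
    using D m unfolding dual_frame_def by blast+
  then have X: "X i m \<in> tangent_space A m" and "is_basis (tangent_space A m) (\<lambda>i. X i m)" for i
    using m unfolding frame_def by (auto intro: vector_field_tangent)
  then obtain r where r: "v = (\<lambda>f. \<Sum>i\<in>UNIV. r i * X i m f)"
    using v unfolding is_basis_def by blast
  have "\<alpha> i m v = r i" for i
    unfolding r one_form_sum[OF \<alpha> m X] delta by (simp add: if_distrib cong: if_cong)
  then show ?thesis using r by simp
qed

text \<open>Otherwise the values of the frame on smooth functions lie in a proper subspace of \<open>\<real>\<^sup>n\<close>, and a
  vector orthogonal to it is a linear relation between the frame vectors.\<close>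

lemma frame_separating_functions:
  fixes X :: "'n::finite \<Rightarrow> 'm vfield"
  assumes "frame A X" and q: "q \<in> points A"
  shows "\<exists>f. (\<forall>k. smooth_fun A (f k)) \<and> (\<forall>k j. X j q (f k) = (if k = j then 1 else 0))"
proof -
  have X: "X j q \<in> tangent_space A q" and basis: "is_basis (tangent_space A q) (\<lambda>j. X j q)" for j
    using assms unfolding frame_def by (auto intro: vector_field_tangent)
  define val :: "('m \<Rightarrow> real) \<Rightarrow> real ^ 'n" where "val = (\<lambda>f. \<chi> j. X j q f)"
  define V where "V = val ` {f. smooth_fun A f}"
  have "subspace V"
    unfolding subspace_def
  proof (intro conjI ballI allI)
    have "val (\<lambda>x. 0) = 0" unfolding val_def using tangent_const[OF X] by (simp add: vec_eq_iff)
    then show "0 \<in> V" unfolding V_def using smooth_fun_const[of A 0] by force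
  next
    fix x y assume "x \<in> V" "y \<in> V"
    then obtain f g where fg: "smooth_fun A f" "x = val f" "smooth_fun A g" "y = val g"
      unfolding V_def by blast
    then have "x + y = val (\<lambda>x. f x + g x)"
      unfolding val_def by (simp add: vec_eq_iff tangent_add[OF X])
    then show "x + y \<in> V" unfolding V_def using smooth_fun_add[OF fg(1,3)] by blast
  next
    fix r x assume "x \<in> V"
    then obtain f where f: "smooth_fun A f" "x = val f" unfolding V_def by blast
    then have "r *\<^sub>R x = val (\<lambda>x. r * f x)"
      unfolding val_def by (simp add: vec_eq_iff tangent_cmult[OF X])
    then show "r *\<^sub>R x \<in> V" unfolding V_def using smooth_fun_cmult[OF f(1)] by blast
  qed
  have "V = UNIV"
  proof (rule ccontr)
    assume "V \<noteq> UNIV"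
    then have "span V \<noteq> UNIV" using \<open>subspace V\<close> by (metis span_eq_iff)
    then obtain a where "a \<noteq> 0" and orth: "\<forall>x\<in>span V. a \<bullet> x = 0"
      using span_not_UNIV_orthogonal by blast
    have "(\<Sum>j\<in>UNIV. a $ j * X j q f) = 0" for f
    proof (cases "smooth_fun A f")
      case True
      then have "val f \<in> span V" unfolding V_def by (intro span_base imageI) simp
      then have "a \<bullet> val f = 0" using orth by simp
      then show ?thesis by (simp add: inner_vec_def val_def)
    next
      case False
      then show ?thesis using tangent_nonsmooth[OF X] by simp
    qed
    \<comment> \<open>Both \<open>a\<close> and the zero tuple are coefficients of the zero tangent
      vector, so uniqueness in \<open>is_basis\<close> contradicts
      \<open>a \<noteq> 0\<close>.\<close>
    then have 1: "(\<lambda>f. 0) = (\<lambda>f. \<Sum>j\<in>UNIV. a $ j * X j q f)" by simp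
    have 2: "(\<lambda>f. 0) = (\<lambda>f. \<Sum>j\<in>UNIV. (\<lambda>j. 0) j * X j q f)" by simp
    have "\<exists>!r. (\<lambda>f. 0) = (\<lambda>f. \<Sum>j\<in>UNIV. r j * X j q f)"
      using basis tangent_space_zero[of A q] unfolding is_basis_def by simp
    then obtain r where r: "\<forall>r'. (\<lambda>f. 0) = (\<lambda>f. \<Sum>j\<in>UNIV. r' j * X j q f) \<longrightarrow> r' = r"
      by (rule ex1E)
    have "($) a = (\<lambda>j. 0)"
      using r[rule_format, OF 1] r[rule_format, OF 2] by simp
    then show False using \<open>a \<noteq> 0\<close> by (simp add: vec_eq_iff fun_eq_iff)
  qed
  \<comment> \<open>Preimages of the standard basis vectors under \<open>val\<close> are the
    required functions.\<close>
  then have "axis k 1 \<in> V" for k by simp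
  then have "\<exists>f. smooth_fun A f \<and> val f = axis k 1" for k
    unfolding V_def by (metis imageE mem_Collect_eq)
  then obtain f where f: "\<And>k. smooth_fun A (f k)" "\<And>k. val (f k) = axis k 1" by metis
  have "X j q (f k) = (if k = j then 1 else 0)" for k j
    using arg_cong[OF f(2)[of k], of "\<lambda>x. x $ j"] by (simp add: val_def axis_def)
  then show ?thesis using f(1) by (intro exI[of _ f]) simp
qed

lemma pushforward_tangent:
  assumes smooth: "\<And>f. smooth_fun B f \<Longrightarrow> smooth_fun A (f \<circ> h)" and v: "v \<in> tangent_space A m"
  shows "pushforward B h v \<in> tangent_space B (h m)"
  using tangent_linear[OF v smooth smooth] tangent_mult[OF v smooth smooth]
  by (intro tangent_spaceI)
    (simp_all add: pushforward_def smooth_fun_add smooth_fun_mult smooth_fun_cmult o_def)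

lemma sum_UNIV_Plus:
  fixes g :: "'a::finite + 'b::finite \<Rightarrow> real"
  shows "(\<Sum>i\<in>UNIV. g i) = (\<Sum>i\<in>UNIV. g (Inl i)) + (\<Sum>i\<in>UNIV. g (Inr i))"
  unfolding UNIV_Plus_UNIV[symmetric] by (subst sum.Plus) auto

section \<open>The bracket of a frame dual to momenta\<close>

text \<open>Extracts from the extended tangent bundle what the frame computations use: a projection
  to a base with constant structure coefficients, momenta \<open>p\<close> and a clock
  \<open>s\<close>. That each \<open>\<theta> i\<close> is a one-form is derived below, in
  \<open>\<theta>_form\<close>.\<close>

locale momentum_frame =
  fixes A :: "('e::euclidean_space, 'q) atlas" and M :: "('f::euclidean_space, 'm) atlas"
    and \<pi> :: "'m \<Rightarrow> 'q"
    and B :: "'n::finite \<Rightarrow> 'q vfield" and \<beta> :: "'n \<Rightarrow> 'q form1" and c :: "'n \<Rightarrow> 'n \<Rightarrow> 'n \<Rightarrow> real"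
    and \<theta> :: "'n \<Rightarrow> 'm form1" and p :: "'n \<Rightarrow> 'm \<Rightarrow> real" and s :: "'m \<Rightarrow> real"
    and Dq Dp :: "'n \<Rightarrow> 'm vfield" and Ds :: "'m vfield"
  assumes proj_points: "m \<in> points M \<Longrightarrow> \<pi> m \<in> points A"
    and proj_smooth: "smooth_fun A f \<Longrightarrow> smooth_fun M (f \<circ> \<pi>)"
    and forms: "one_form A (\<beta> i)"
    and B_dual: "dual_frame A B \<beta>"
    and structure_constants: "q \<in> points A \<Longrightarrow>
          lie_bracket (B i) (B j) q = (\<lambda>f. \<Sum>k\<in>UNIV. c k i j * B k q f)"
    and \<theta>: "\<theta> i = pullback A \<pi> (\<beta> i)"
    and p_smooth: "smooth_fun M (p i)"
    and s_smooth: "smooth_fun M s"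
    and D_dual: "dual_frame M (join Dq Dp Ds)
          (join \<theta> (\<lambda>i. differential (p i)) (differential s))"
begin

section \<open>The pulled-back coframe and its Maurer-Cartan equation\<close>

lemma \<theta>_eq: "\<theta> i m v = \<beta> i (\<pi> m) (pushforward A \<pi> v)"
  by (simp add: \<theta> pullback_def)

lemma B_field: "vector_field A (B i)"
  by (rule dual_frame_vector_field[OF B_dual])

lemma \<beta>_B: "q \<in> points A \<Longrightarrow> \<beta> i q (B j q) = (if i = j then 1 else 0)"
  by (rule dual_frame_delta[OF B_dual])

lemma D_field: "vector_field M (Dq i)" "vector_field M (Dp i)" "vector_field M Ds"
proof -
  note D = dual_frame_vector_field[OF D_dual]
  show "vector_field M (Dq i)" "vector_field M (Dp i)" "vector_field M Ds"
    using D[of "Inl i"] D[of "Inr (Inl i)"] D[of "Inr (Inr ())"] by (simp_all add: join_def)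
qed

lemma D_values:
  assumes "m \<in> points M"
  shows "\<theta> i m (Dq j m) = (if i = j then 1 else 0)" "\<theta> i m (Dp j m) = 0"
    "Dq j m (p i) = 0" "Dp j m (p i) = (if i = j then 1 else 0)"
    "Dq j m s = 0" "Dp j m s = 0"
proof -
  note D = dual_frame_delta[OF D_dual assms]
  show "\<theta> i m (Dq j m) = (if i = j then 1 else 0)" "\<theta> i m (Dp j m) = 0"
    using D[of "Inl i" "Inl j"] D[of "Inl i" "Inr (Inl j)"] by (simp_all add: join_def)
  show "Dq j m (p i) = 0" "Dp j m (p i) = (if i = j then 1 else 0)"
    using D[of "Inr (Inl i)" "Inl j"] D[of "Inr (Inl i)" "Inr (Inl j)"]
    by (simp_all add: join_def differential_def)
  show "Dq j m s = 0" "Dp j m s = 0"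
    using D[of "Inr (Inr ())" "Inl j"] D[of "Inr (Inr ())" "Inr (Inl j)"]
    by (simp_all add: join_def differential_def)
qed

lemma pushforward_proj: "v \<in> tangent_space M m \<Longrightarrow> pushforward A \<pi> v \<in> tangent_space A (\<pi> m)"
  by (rule pushforward_tangent[OF proj_smooth])

text \<open>The numbers \<open>\<theta> j m v\<close> are the coefficients of the pushed-forward
  vector in the frame \<open>B\<close>.\<close>

lemma pushforward_expansion:
  assumes m: "m \<in> points M" and v: "v \<in> tangent_space M m" and f: "smooth_fun A f"
  shows "v (f \<circ> \<pi>) = (\<Sum>j\<in>UNIV. \<theta> j m v * B j (\<pi> m) f)"
proof -
  have "pushforward A \<pi> v f = (\<Sum>j\<in>UNIV. \<theta> j m v * B j (\<pi> m) f)"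
    unfolding \<theta>_eq
    by (rule dual_frame_expansion[OF B_dual forms proj_points[OF m] pushforward_proj[OF v]])
  then show ?thesis using f by (simp add: pushforward_def)
qed

text \<open>The functions \<open>\<theta>\<^sup>j(X)\<close> solve a linear system with smooth coefficients which near a given point
  is uniquely solvable.\<close>

lemma \<theta>_smooth:
  assumes X: "vector_field M X"
  shows "smooth_fun M (\<lambda>m. \<theta> i m (X m))"
proof (rule smooth_fun_solution[of M "\<lambda>i m. \<theta> i m (X m)"])
  fix m\<^sub>0 assume m0: "m\<^sub>0 \<in> points M"
  have "frame A B" using B_dual by (simp add: dual_frame_def)
  from frame_separating_functions[OF this proj_points[OF m0]]
  obtain f where f: "smooth_fun A (f k)" and delta: "B j (\<pi> m\<^sub>0) (f k) = (if k = j then 1 else 0)"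
    for k j by auto
  \<comment> \<open>The system is \<open>pushforward_expansion\<close> for the test functions
    \<open>f k\<close>; its matrix at \<open>m\<^sub>0\<close> is the identity by the choice of
    \<open>f\<close>.\<close>
  define a where "a = (\<lambda>k j m. B j (\<pi> m) (f k))"
  define h where "h = (\<lambda>k m. X m (f k \<circ> \<pi>))"
  have a: "smooth_fun M (a k j)" for k j
    unfolding a_def using proj_smooth[OF vector_field_smooth[OF B_field f]] by (simp add: o_def)
  have h: "smooth_fun M (h k)" for k
    unfolding h_def by (rule vector_field_smooth[OF X proj_smooth[OF f]])
  have "(\<chi> k j. a k j m\<^sub>0) = mat 1"
    by (simp add: a_def delta mat_def)
  then have det: "det (\<chi> k j. a k j m\<^sub>0) \<noteq> 0" by simp
  have "(\<Sum>j\<in>UNIV. a k j m * \<theta> j m (X m)) = h k m" if "m \<in> points M" for k m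
    using pushforward_expansion[OF that vector_field_tangent[OF X that] f]
    by (simp add: a_def h_def mult.commute)
  with a h det show "\<exists>a h. (\<forall>i j. smooth_fun M (a i j)) \<and> (\<forall>i. smooth_fun M (h i)) \<and>
      det (\<chi> i j. a i j m\<^sub>0) \<noteq> 0 \<and>
      (\<forall>i. \<forall>m\<in>points M. (\<Sum>j\<in>UNIV. a i j m * \<theta> j m (X m)) = h i m)"
    by (intro exI[of _ a] exI[of _ h]) simp
qed

lemma \<theta>_form: "one_form M (\<theta> i)"
  unfolding one_form_def
proof (intro conjI ballI allI impI)
  fix m v w r t assume m: "m \<in> points M" and vw: "v \<in> tangent_space M m" "w \<in> tangent_space M m"
  have "pushforward A \<pi> (\<lambda>f. r * v f + t * w f) =
      (\<lambda>f. r * pushforward A \<pi> v f + t * pushforward A \<pi> w f)"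
    by (auto simp: pushforward_def)
  then show "\<theta> i m (\<lambda>f. r * v f + t * w f) = r * \<theta> i m v + t * \<theta> i m w"
    unfolding \<theta>_eq
    by (simp add: one_form_linear[OF forms proj_points[OF m]] pushforward_proj vw)
qed (rule \<theta>_smooth)

text \<open>The Maurer-Cartan equation. Expanding \<open>[X, Y]\<close> on functions
  \<open>f \<circ> \<pi>\<close> in the frame \<open>B\<close>, the second-order terms combine to
  commutators of \<open>B\<close>, that is, to the structure constants.\<close>

lemma ext_deriv_\<theta>:
  assumes X: "vector_field M X" and Y: "vector_field M Y" and m: "m \<in> points M"
  shows "ext_deriv (\<theta> k) X Y m = - (\<Sum>i\<in>UNIV. \<Sum>j\<in>UNIV. c k i j * \<theta> i m (X m) * \<theta> j m (Y m))"
proof -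
  \<comment> \<open>The value that \<open>\<theta> k\<close> must take on
    \<open>[X, Y]\<close>.\<close>
  define R where "R = (\<lambda>k. X m (\<lambda>q. \<theta> k q (Y q)) - Y m (\<lambda>q. \<theta> k q (X q)) +
      (\<Sum>i\<in>UNIV. \<Sum>j\<in>UNIV. c k i j * \<theta> i m (X m) * \<theta> j m (Y m)))"
  \<comment> \<open>Expanding twice: one sum differentiates the coefficients of \<open>W\<close>,
    the other differentiates \<open>B j f\<close> on the base.\<close>
  have iterate: "V m (\<lambda>q. W q (f \<circ> \<pi>)) = (\<Sum>k\<in>UNIV. V m (\<lambda>q. \<theta> k q (W q)) * B k (\<pi> m) f) +
      (\<Sum>i\<in>UNIV. \<Sum>j\<in>UNIV. \<theta> i m (V m) * \<theta> j m (W m) * B i (\<pi> m) (\<lambda>q. B j q f))"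
    if V: "vector_field M V" and W: "vector_field M W" and f: "smooth_fun A f" for V W f
  proof -
    note Vm = vector_field_tangent[OF V m]
    have Bf: "smooth_fun A (\<lambda>q. B j q f)" for j by (rule vector_field_smooth[OF B_field f])
    have Bf': "smooth_fun M (\<lambda>q. B j (\<pi> q) f)" for j using proj_smooth[OF Bf] by (simp add: o_def)
    have "V m (\<lambda>q. W q (f \<circ> \<pi>)) = V m (\<lambda>q. \<Sum>j\<in>UNIV. \<theta> j q (W q) * B j (\<pi> q) f)"
      by (rule tangent_cong[OF Vm m])
        (rule pushforward_expansion[OF _ vector_field_tangent[OF W] f])
    also have "\<dots> = (\<Sum>j\<in>UNIV. V m (\<lambda>q. \<theta> j q (W q) * B j (\<pi> q) f))"
      by (rule tangent_sum[OF Vm smooth_fun_mult[OF \<theta>_smooth[OF W] Bf']])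
    also have "\<dots> = (\<Sum>j\<in>UNIV. \<theta> j m (W m) * V m (\<lambda>q. B j (\<pi> q) f)
        + B j (\<pi> m) f * V m (\<lambda>q. \<theta> j q (W q)))"
      by (rule sum.cong[OF refl]) (rule tangent_mult[OF Vm \<theta>_smooth[OF W] Bf'])
    also have "\<dots> = (\<Sum>j\<in>UNIV. \<theta> j m (W m) *
          (\<Sum>i\<in>UNIV. \<theta> i m (V m) * B i (\<pi> m) (\<lambda>q. B j q f))
        + B j (\<pi> m) f * V m (\<lambda>q. \<theta> j q (W q)))"
      using pushforward_expansion[OF m Vm Bf] by (simp add: o_def)
    also have "\<dots> = (\<Sum>k\<in>UNIV. V m (\<lambda>q. \<theta> k q (W q)) * B k (\<pi> m) f) +
        (\<Sum>j\<in>UNIV. \<Sum>i\<in>UNIV. \<theta> i m (V m) * \<theta> j m (W m) * B i (\<pi> m) (\<lambda>q. B j q f))"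
      by (simp add: sum.distrib sum_distrib_left algebra_simps)
    also have "(\<Sum>j\<in>UNIV. \<Sum>i\<in>UNIV. \<theta> i m (V m) * \<theta> j m (W m) * B i (\<pi> m) (\<lambda>q. B j q f)) =
        (\<Sum>i\<in>UNIV. \<Sum>j\<in>UNIV. \<theta> i m (V m) * \<theta> j m (W m) * B i (\<pi> m) (\<lambda>q. B j q f))"
      by (rule sum.swap)
    finally show ?thesis .
  qed
  have BB: "B i (\<pi> m) (\<lambda>q. B j q f) - B j (\<pi> m) (\<lambda>q. B i q f) = (\<Sum>k\<in>UNIV. c k i j * B k (\<pi> m) f)"
    for i j f
    using fun_cong[OF structure_constants[OF proj_points[OF m]]] by (simp add: lie_bracket_def)
  \<comment> \<open>Equality is needed for every \<open>f\<close>, since \<open>\<beta> k\<close> is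
    applied to the whole tangent vector; both sides are 0 if \<open>f\<close> is not smooth.\<close>
  have "pushforward A \<pi> (lie_bracket X Y m) f = (\<Sum>k\<in>UNIV. R k * B k (\<pi> m) f)" for f
  proof (cases "smooth_fun A f")
    case f: True
    \<comment> \<open>Exchanging \<open>i\<close> and \<open>j\<close> in the subtracted sum gives
      both sums the same coefficients, so that \<open>BB\<close> applies.\<close>
    have "(\<Sum>i\<in>UNIV. \<Sum>j\<in>UNIV. \<theta> i m (X m) * \<theta> j m (Y m) * B i (\<pi> m) (\<lambda>q. B j q f)) -
        (\<Sum>i\<in>UNIV. \<Sum>j\<in>UNIV. \<theta> i m (Y m) * \<theta> j m (X m) * B i (\<pi> m) (\<lambda>q. B j q f)) =
        (\<Sum>i\<in>UNIV. \<Sum>j\<in>UNIV. \<theta> i m (X m) * \<theta> j m (Y m) * B i (\<pi> m) (\<lambda>q. B j q f)) -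
        (\<Sum>i\<in>UNIV. \<Sum>j\<in>UNIV. \<theta> i m (X m) * \<theta> j m (Y m) * B j (\<pi> m) (\<lambda>q. B i q f))"
      by (subst (3) sum.swap) (simp add: mult.commute)
    also have "\<dots> = (\<Sum>i\<in>UNIV. \<Sum>j\<in>UNIV. \<theta> i m (X m) * \<theta> j m (Y m) * (\<Sum>k\<in>UNIV. c k i j * B k (\<pi> m) f))"
      unfolding BB[symmetric] by (simp add: sum_subtractf right_diff_distrib)
    also have "\<dots> = (\<Sum>i\<in>UNIV. \<Sum>j\<in>UNIV. \<Sum>k\<in>UNIV. c k i j * \<theta> i m (X m) * \<theta> j m (Y m) * B k (\<pi> m) f)"
      by (simp add: sum_distrib_left mult_ac)
    also have "\<dots> = (\<Sum>i\<in>UNIV. \<Sum>k\<in>UNIV. \<Sum>j\<in>UNIV. c k i j * \<theta> i m (X m) * \<theta> j m (Y m) * B k (\<pi> m) f)"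
      by (rule sum.cong[OF refl]) (rule sum.swap)
    also have "\<dots> = (\<Sum>k\<in>UNIV. \<Sum>i\<in>UNIV. \<Sum>j\<in>UNIV. c k i j * \<theta> i m (X m) * \<theta> j m (Y m) * B k (\<pi> m) f)"
      by (rule sum.swap)
    also have "\<dots> = (\<Sum>k\<in>UNIV. (\<Sum>i\<in>UNIV. \<Sum>j\<in>UNIV. c k i j * \<theta> i m (X m) * \<theta> j m (Y m)) * B k (\<pi> m) f)"
      by (simp add: sum_distrib_right)
    finally have "lie_bracket X Y m (f \<circ> \<pi>) = (\<Sum>k\<in>UNIV. R k * B k (\<pi> m) f)"
      unfolding lie_bracket_def iterate[OF X Y f] iterate[OF Y X f] R_def
      by (simp add: sum.distrib sum_subtractf distrib_right left_diff_distrib)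
    then show ?thesis using f by (simp add: pushforward_def)
  next
    case False
    then show ?thesis
      using tangent_nonsmooth[OF vector_field_tangent[OF B_field proj_points[OF m]]]
      by (simp add: pushforward_def)
  qed
  then have "pushforward A \<pi> (lie_bracket X Y m) = (\<lambda>f. \<Sum>k\<in>UNIV. R k * B k (\<pi> m) f)" by blast
  then have "\<theta> k m (lie_bracket X Y m) = (\<Sum>j\<in>UNIV. R j * \<beta> k (\<pi> m) (B j (\<pi> m)))"
    unfolding \<theta>_eq
    using one_form_sum[OF forms proj_points[OF m] vector_field_tangent[OF B_field proj_points[OF m]]]
    by simp
  also have "\<dots> = R k"
    unfolding \<beta>_B[OF proj_points[OF m]] by (simp add: if_distrib cong: if_cong)
  finally show ?thesis unfolding ext_deriv_def R_def by simp
qed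

section \<open>The form \<open>p\<^sub>i \<theta>\<^sup>i\<close>, the bracket and its Hamiltonian
  fields\<close>

definition canonical_form :: "'m form1" where
  "canonical_form = (\<lambda>m v. \<Sum>i\<in>UNIV. p i m * \<theta> i m v)"

lemma canonical_form: "one_form M canonical_form"
  unfolding canonical_form_def by (rule one_form_combination[OF \<theta>_form p_smooth])

lemma ext_deriv_canonical_form:
  assumes X: "vector_field M X" and Y: "vector_field M Y" and m: "m \<in> points M"
  shows "ext_deriv canonical_form X Y m =
    (\<Sum>k\<in>UNIV. X m (p k) * \<theta> k m (Y m) - Y m (p k) * \<theta> k m (X m)
      - (\<Sum>i\<in>UNIV. \<Sum>j\<in>UNIV. p k m * c k i j * \<theta> i m (X m) * \<theta> j m (Y m)))"
  unfolding canonical_form_def ext_deriv_combination[OF \<theta>_form p_smooth X Y m] ext_deriv_\<theta>[OF X Y m]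
  by (simp add: sum_distrib_left algebra_simps)

definition bracket :: "('m \<Rightarrow> real) \<Rightarrow> ('m \<Rightarrow> real) \<Rightarrow> 'm \<Rightarrow> real" where
  "bracket F G m = (\<Sum>i\<in>UNIV. Dq i m F * Dp i m G - Dp i m F * Dq i m G) +
     (\<Sum>k\<in>UNIV. \<Sum>i\<in>UNIV. \<Sum>j\<in>UNIV. p k m * c k i j * (Dp j m F * Dp i m G))"

text \<open>\<open>F\<close> occupies the second slot, so that the evolution under \<open>F\<close>
  reads \<open>{\<phi>, F}\<close> without a sign.\<close>

definition hamiltonian_field :: "('m \<Rightarrow> real) \<Rightarrow> 'm vfield" where
  "hamiltonian_field F = (\<lambda>m \<phi>. bracket \<phi> F m)"

text \<open>The right-hand side of Hamilton's equation for the momentum \<open>p j\<close>, with its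
  coadjoint term coming from the structure constants.\<close>

definition force :: "('m \<Rightarrow> real) \<Rightarrow> 'n \<Rightarrow> 'm \<Rightarrow> real" where
  "force F j m = (\<Sum>k\<in>UNIV. \<Sum>i\<in>UNIV. p k m * c k i j * Dp i m F) - Dq j m F"

text \<open>Regrouping by frame fields exhibits the components and the absence of a
  \<open>Ds\<close> part.\<close>

lemma hamiltonian_field_eq:
  "hamiltonian_field F = (\<lambda>m \<phi>. (\<Sum>i\<in>UNIV. Dp i m F * Dq i m \<phi>) + (\<Sum>j\<in>UNIV. force F j m * Dp j m \<phi>))"
proof (intro ext)
  fix m \<phi>
  have "(\<Sum>k\<in>UNIV. \<Sum>i\<in>UNIV. \<Sum>j\<in>UNIV. p k m * c k i j * (Dp j m \<phi> * Dp i m F)) =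
      (\<Sum>k\<in>UNIV. \<Sum>j\<in>UNIV. \<Sum>i\<in>UNIV. p k m * c k i j * (Dp j m \<phi> * Dp i m F))"
    by (rule sum.cong[OF refl]) (rule sum.swap)
  also have "\<dots> = (\<Sum>j\<in>UNIV. \<Sum>k\<in>UNIV. \<Sum>i\<in>UNIV. p k m * c k i j * (Dp j m \<phi> * Dp i m F))"
    by (rule sum.swap)
  also have "\<dots> = (\<Sum>j\<in>UNIV. (\<Sum>k\<in>UNIV. \<Sum>i\<in>UNIV. p k m * c k i j * Dp i m F) * Dp j m \<phi>)"
    by (simp add: sum_distrib_right sum_distrib_left mult_ac)
  finally show "hamiltonian_field F m \<phi> =
      (\<Sum>i\<in>UNIV. Dp i m F * Dq i m \<phi>) + (\<Sum>j\<in>UNIV. force F j m * Dp j m \<phi>)"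
    unfolding hamiltonian_field_def bracket_def force_def
    by (simp add: sum_subtractf algebra_simps)
qed

lemma hamiltonian_field:
  assumes F: "smooth_fun M F"
  shows "vector_field M (hamiltonian_field F)"
proof -
  have DF: "smooth_fun M (\<lambda>m. Dp i m F)" "smooth_fun M (\<lambda>m. Dq i m F)" for i
    using D_field[THEN vector_field_smooth, OF F] by auto
  have pcD: "smooth_fun M (\<lambda>m. p k m * c k i j * Dp i m F)" for i j k
    by (rule smooth_fun_mult[OF smooth_fun_mult[OF p_smooth smooth_fun_const] DF(1)])
  have force: "smooth_fun M (force F j)" for j
    unfolding force_def[abs_def]
    by (rule smooth_fun_diff[OF _ DF(2)], rule smooth_fun_sum, rule smooth_fun_sum, rule pcD)
  show ?thesis
    unfolding hamiltonian_field_eq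
    by (rule vector_field_add[OF vector_field_lincomb[OF D_field(1) DF(1)]
          vector_field_lincomb[OF D_field(2) force]])
qed

lemma hamiltonian_field_values:
  assumes m: "m \<in> points M"
  shows "\<theta> i m (hamiltonian_field F m) = Dp i m F"
    "hamiltonian_field F m (p i) = force F i m"
    "hamiltonian_field F m s = 0"
proof -
  note DT = D_field[THEN vector_field_tangent, OF m]
  have "\<theta> i m (hamiltonian_field F m) =
      (\<Sum>j\<in>UNIV. Dp j m F * \<theta> i m (Dq j m)) + (\<Sum>j\<in>UNIV. force F j m * \<theta> i m (Dp j m))"
    unfolding hamiltonian_field_eq
      one_form_add[OF \<theta>_form m tangent_space_sum[OF DT(1)] tangent_space_sum[OF DT(2)]]
      one_form_sum[OF \<theta>_form m DT(1)] one_form_sum[OF \<theta>_form m DT(2)] ..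
  then show "\<theta> i m (hamiltonian_field F m) = Dp i m F"
    by (simp add: D_values[OF m] if_distrib cong: if_cong)
  show "hamiltonian_field F m (p i) = force F i m" "hamiltonian_field F m s = 0"
    by (simp_all add: hamiltonian_field_eq D_values[OF m] if_distrib cong: if_cong)
qed

lemma D_expansion:
  assumes m: "m \<in> points M" and v: "v \<in> tangent_space M m"
  shows "v F = (\<Sum>i\<in>UNIV. \<theta> i m v * Dq i m F) + (\<Sum>i\<in>UNIV. v (p i) * Dp i m F) + v s * Ds m F"
proof -
  have "one_form M (join \<theta> (\<lambda>i. differential (p i)) (differential s) i)" for i
    using \<theta>_form one_form_differential[OF p_smooth] one_form_differential[OF s_smooth]
    by (simp add: join_def split: sum.split)
  from dual_frame_expansion[OF D_dual this m v, of F] show ?thesis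
    by (simp add: sum_UNIV_Plus UNIV_unit join_def differential_def)
qed

text \<open>The coadjoint part of \<open>force\<close> cancels the Maurer-Cartan term of
  \<open>ext_deriv_canonical_form\<close>. What is left is minus the expansion of
  \<open>W m F\<close> in the frame, without its \<open>Ds\<close> part.\<close>

lemma ext_deriv_hamiltonian_field:
  assumes F: "smooth_fun M F" and W: "vector_field M W" and m: "m \<in> points M"
  shows "ext_deriv canonical_form (hamiltonian_field F) W m = W m s * Ds m F - W m F"
proof -
  have "(\<Sum>k\<in>UNIV. \<Sum>i\<in>UNIV. \<Sum>j\<in>UNIV. p k m * c k i j * Dp i m F * \<theta> j m (W m)) =
      (\<Sum>k\<in>UNIV. \<Sum>j\<in>UNIV. \<Sum>i\<in>UNIV. p k m * c k i j * Dp i m F * \<theta> j m (W m))"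
    by (rule sum.cong[OF refl]) (rule sum.swap)
  also have "\<dots> = (\<Sum>j\<in>UNIV. \<Sum>k\<in>UNIV. \<Sum>i\<in>UNIV. p k m * c k i j * Dp i m F * \<theta> j m (W m))"
    by (rule sum.swap)
  also have "\<dots> = (\<Sum>j\<in>UNIV. (force F j m + Dq j m F) * \<theta> j m (W m))"
    by (simp add: force_def sum_distrib_right)
  finally show ?thesis
    unfolding ext_deriv_canonical_form[OF hamiltonian_field[OF F] W m] hamiltonian_field_values[OF m]
      D_expansion[OF m vector_field_tangent[OF W m], of F] sum_subtractf
    by (simp add: sum.distrib algebra_simps)
qed

text \<open>The field of \<open>G\<close> has no \<open>s\<close> component, so pairing it with the
  field of \<open>F\<close> leaves only \<open>- bracket F G m\<close>; the sign change is inherited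
  from the exterior derivative.\<close>

lemma bracket_antisym:
  assumes F: "smooth_fun M F" and G: "smooth_fun M G" and m: "m \<in> points M"
  shows "bracket F G m = - bracket G F m"
proof -
  have "ext_deriv canonical_form (hamiltonian_field F) (hamiltonian_field G) m = - bracket F G m"
    if "smooth_fun M F" "smooth_fun M G" for F G
    using ext_deriv_hamiltonian_field[OF that(1) hamiltonian_field[OF that(2)] m]
      hamiltonian_field_values(3)[OF m] by (simp add: hamiltonian_field_def)
  then show ?thesis
    using ext_deriv_antisym[OF canonical_form hamiltonian_field[OF F] hamiltonian_field[OF G] m] F G
    by simp
qed

lemma bracket_smooth:
  "smooth_fun M F \<Longrightarrow> smooth_fun M G \<Longrightarrow> smooth_fun M (bracket F G)"
  using vector_field_smooth[OF hamiltonian_field, of G F] by (simp add: hamiltonian_field_def)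


text \<open>In \<open>ext_deriv_closed\<close> the left side contains each of the three cyclic terms
  once and the right side contains each twice, so their sum is 0.\<close>

lemma bracket_jacobi:
  assumes F: "smooth_fun M F" and G: "smooth_fun M G" and K: "smooth_fun M K" and m: "m \<in> points M"
  shows "bracket F (bracket G K) m + bracket G (bracket K F) m + bracket K (bracket F G) m = 0"
proof -
  note ham = hamiltonian_field
  \<comment> \<open>Two signs cancel: the 2-form gives \<open>- {V, W}\<close>, and moving
    \<open>U\<close> to the first slot gives another minus.\<close>
  have outer: "hamiltonian_field U m (ext_deriv canonical_form (hamiltonian_field V) (hamiltonian_field W))
      = bracket U (bracket V W) m"
    if U: "smooth_fun M U" and V: "smooth_fun M V" and W: "smooth_fun M W" for U V W
  proof -
    note T = vector_field_tangent[OF ham[OF U] m]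
    have "ext_deriv canonical_form (hamiltonian_field V) (hamiltonian_field W) q = - 1 * bracket V W q"
      if "q \<in> points M" for q
      using ext_deriv_hamiltonian_field[OF V ham[OF W] that] hamiltonian_field_values(3)[OF that]
      by (simp add: hamiltonian_field_def)
    then have "hamiltonian_field U m
        (ext_deriv canonical_form (hamiltonian_field V) (hamiltonian_field W)) =
        hamiltonian_field U m (\<lambda>q. - 1 * bracket V W q)"
      by (rule tangent_cong[OF T m])
    also have "\<dots> = - bracket (bracket V W) U m"
      using tangent_cmult[OF T bracket_smooth[OF V W], of "-1"] by (simp add: hamiltonian_field_def)
    finally show ?thesis using bracket_antisym[OF U bracket_smooth[OF V W] m] by simp
  qed
  \<comment> \<open>The bracket of the two fields also annihilates \<open>s\<close>, so pairing it
    with the field of \<open>W\<close> just applies it to \<open>W\<close>.\<close>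
  have inner: "ext_deriv canonical_form (lie_bracket (hamiltonian_field U) (hamiltonian_field V))
      (hamiltonian_field W) m = bracket U (bracket V W) m + bracket V (bracket W U) m"
    if U: "smooth_fun M U" and V: "smooth_fun M V" and W: "smooth_fun M W" for U V W
  proof -
    note UV = vector_field_lie_bracket[OF ham[OF U] ham[OF V]]
    \<comment> \<open>The inner function is 0 only on \<open>points M\<close>, hence the detour
      through \<open>tangent_cong\<close>.\<close>
    have zero: "hamiltonian_field U m (\<lambda>q. hamiltonian_field V q s) = 0" if "smooth_fun M U" for U V
      using tangent_cong[OF vector_field_tangent[OF ham[OF that] m] m, of _ "\<lambda>q. 0"]
        hamiltonian_field_values(3) tangent_const[OF vector_field_tangent[OF ham[OF that] m]] by simp
    then have "lie_bracket (hamiltonian_field U) (hamiltonian_field V) m s = 0"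
      using U V by (simp add: lie_bracket_def)
    then have "ext_deriv canonical_form (lie_bracket (hamiltonian_field U) (hamiltonian_field V))
        (hamiltonian_field W) m = lie_bracket (hamiltonian_field U) (hamiltonian_field V) m W"
      using ext_deriv_hamiltonian_field[OF W UV m] ext_deriv_antisym[OF canonical_form UV ham[OF W] m]
      by simp
    also have "\<dots> = bracket (bracket W V) U m - bracket (bracket W U) V m"
      by (simp add: lie_bracket_def hamiltonian_field_def)
    also have "bracket (bracket W V) U m = bracket U (bracket V W) m"
    proof -
      have "bracket (bracket W V) U m = hamiltonian_field U m (\<lambda>q. - 1 * bracket V W q)"
        unfolding hamiltonian_field_def[symmetric, THEN fun_cong, THEN fun_cong]
        using tangent_cong[OF vector_field_tangent[OF ham[OF U] m] m, of "bracket W V"]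
          bracket_antisym[OF W V] by (simp add: hamiltonian_field_def)
      also have "\<dots> = - bracket (bracket V W) U m"
        using tangent_cmult[OF vector_field_tangent[OF ham[OF U] m] bracket_smooth[OF V W], of "-1"]
        by (simp add: hamiltonian_field_def)
      finally show ?thesis using bracket_antisym[OF U bracket_smooth[OF V W] m] by simp
    qed
    finally show ?thesis using bracket_antisym[OF V bracket_smooth[OF W U] m] by simp
  qed
  show ?thesis
    using ext_deriv_closed[OF canonical_form ham[OF F] ham[OF G] ham[OF K] m]
    unfolding outer[OF F G K] outer[OF G K F] outer[OF K F G]
      inner[OF F G K] inner[OF G K F] inner[OF K F G]
    by simp
qed

lemma poisson_bracket: "poisson_bracket M bracket"
  unfolding poisson_bracket_def
proof (intro allI impI conjI ballI)
  fix F G K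
  assume F: "smooth_fun M F" and G: "smooth_fun M G" and K: "smooth_fun M K"
  show "smooth_fun M (bracket F G)" by (rule bracket_smooth[OF F G])
  fix m assume m: "m \<in> points M"
  \<comment> \<open>For fixed \<open>K\<close> the map taking \<open>F\<close> to
    \<open>bracket F K m\<close> is a tangent vector. This settles the first slot; antisymmetry
    transfers it to the second.\<close>
  note T = vector_field_tangent[OF hamiltonian_field[OF K] m, unfolded hamiltonian_field_def]
  have lin: "bracket (\<lambda>x. r * F x + t * G x) K m = r * bracket F K m + t * bracket G K m" for r t
    by (rule tangent_linear[OF T F G])
  have leib: "bracket (\<lambda>x. F x * G x) K m = F m * bracket G K m + G m * bracket F K m"
    by (rule tangent_mult[OF T F G])
  show "bracket (\<lambda>x. r * F x + t * G x) K m = r * bracket F K m + t * bracket G K m" for r t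
    by (rule lin)
  show "bracket (\<lambda>x. F x * G x) K m = F m * bracket G K m + G m * bracket F K m"
    by (rule leib)
  show "bracket F G m = - bracket G F m" by (rule bracket_antisym[OF F G m])
  show "bracket K (\<lambda>x. r * F x + t * G x) m = r * bracket K F m + t * bracket K G m" for r t
    using lin[of r t] bracket_antisym[OF K _ m] F G
    by (simp add: smooth_fun_add smooth_fun_cmult)
  show "bracket K (\<lambda>x. F x * G x) m = F m * bracket K G m + G m * bracket K F m"
    using leib bracket_antisym[OF K _ m] F G by (simp add: smooth_fun_mult)
  show "bracket F (bracket G K) m + bracket G (bracket K F) m + bracket K (bracket F G) m = 0"
    by (rule bracket_jacobi[OF F G K m])
qed


text \<open>Tested on the field of \<phi>, which annihilates \<open>s\<close>, the term
  \<open>d(H ds)\<close> gives \<open>- {H, \<phi>} ds(X)\<close>, while the canonical form gives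
  \<open>X(\<phi>) - ds(X) Ds(\<phi>)\<close>. Nullity equates the two.\<close>

lemma null_field:
  assumes X: "vector_field M X" and H: "smooth_fun M H" and \<phi>: "smooth_fun M \<phi>" and m: "m \<in> points M"
    and null: "\<And>W. vector_field M W \<Longrightarrow>
      ext_deriv (\<lambda>m v. canonical_form m v - H m * differential s m v) X W m = 0"
  shows "X m \<phi> = X m s * (bracket \<phi> H m + Ds m \<phi>)"
proof -
  let ?W = "hamiltonian_field \<phi>"
  note W = hamiltonian_field[OF \<phi>]
  note ds = one_form_differential[OF s_smooth]
  \<comment> \<open>\<open>H ds\<close> is treated as a sum over the one-element set
    \<open>{()}\<close>.\<close>
  have Hds: "one_form M (\<lambda>m v. H m * differential s m v)"
    using one_form_combination[of "{()}" M "\<lambda>_. differential s" "\<lambda>_. H"] ds H by simp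
  have "ext_deriv (\<lambda>m v. H m * differential s m v) X ?W m = X m H * ?W m s - ?W m H * X m s"
    using ext_deriv_combination[of "{()}" M "\<lambda>_. differential s" "\<lambda>_. H", OF _ _ X W m] ds H
    by (simp add: ext_deriv_differential, simp add: differential_def)
  then have "ext_deriv canonical_form X ?W m = - bracket H \<phi> m * X m s"
    using null[OF W] ext_deriv_diff[OF canonical_form Hds X W m] hamiltonian_field_values(3)[OF m, of \<phi>]
    by (simp add: hamiltonian_field_def)
  then show ?thesis
    using ext_deriv_antisym[OF canonical_form X W m] ext_deriv_hamiltonian_field[OF \<phi> X m]
      bracket_antisym[OF H \<phi> m] by (simp add: algebra_simps)
qed

end

section \<open>The extended tangent bundle\<close>

text \<open>With \<open>h'\<close> the derivative of \<open>h\<close>, the chain rule multiplies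
  \<open>X\<close> by \<open>h'\<close>. For the clock \<tau> the composite is the identity, so
  \<open>X(\<tau>) h' = 1\<close>, and this factor drops out of \<open>eq\<close>.\<close>

lemma integral_curve_clock:
  assumes \<gamma>: "integral_curve A X I \<gamma>" and h: "h differentiable_on K" and hK: "h ` K \<subseteq> I"
    and clock: "\<And>u. u \<in> K \<Longrightarrow> \<tau> (\<gamma> (h u)) = u"
    and \<tau>: "smooth_fun A \<tau>" and \<phi>: "smooth_fun A \<phi>" and u: "u \<in> K"
    and eq: "X (\<gamma> (h u)) \<phi> = X (\<gamma> (h u)) \<tau> * d"
  shows "((\<lambda>u. \<phi> (\<gamma> (h u))) has_real_derivative d) (at u within K)"
\<comment> \<open>At an isolated point of \<open>K\<close> every number is a derivative. Elsewhere
  derivatives are unique, as the comparison with the identity requires.\<close>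
proof (cases "at u within K = bot")
  case True
  then show ?thesis by (simp add: has_field_derivative_iff)
next
  case False
  obtain h' where h': "(h has_real_derivative h') (at u within K)"
    using h u unfolding differentiable_on_def real_differentiable_def by blast
  have chain: "((\<lambda>u. f (\<gamma> (h u))) has_real_derivative X (\<gamma> (h u)) f * h') (at u within K)"
    if f: "smooth_fun A f" for f
  proof -
    have "((\<lambda>u. f (\<gamma> u)) has_real_derivative X (\<gamma> (h u)) f) (at (h u) within I)"
      using \<gamma> f u hK unfolding integral_curve_def by blast
    then have "((\<lambda>u. f (\<gamma> u)) has_real_derivative X (\<gamma> (h u)) f) (at (h u) within h ` K)"
      using hK by (rule DERIV_subset)
    from DERIV_image_chain[OF this h'] show ?thesis by (simp add: o_def)
  qed
  have "((\<lambda>u. u) has_real_derivative X (\<gamma> (h u)) \<tau> * h') (at u within K)"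
    by (rule has_field_derivative_transform_within[OF chain[OF \<tau>], of 1]) (use u clock in auto)
  moreover have "((\<lambda>u. u) has_real_derivative 1) (at u within K)" by (rule DERIV_ident)
  ultimately have "X (\<gamma> (h u)) \<tau> * h' = 1"
    unfolding has_field_derivative_iff using tendsto_unique[OF False] by blast
  then have "X (\<gamma> (h u)) \<phi> * h' = d" unfolding eq by (simp add: mult_ac)
  then show ?thesis using chain[OF \<phi>] by simp
qed

lemma points_extended_tangent_atlas:
  assumes "m \<in> points (extended_tangent_atlas A a b)"
  shows "base_pt m \<in> points A"
  using assms
  by (fastforce simp: points_def extended_tangent_atlas_def prod_atlas_def tangent_atlas_def base_pt_def)

text \<open>In the charts of the extended bundle the projection is the linear map taking
  \<open>((x, w), s)\<close> to \<open>x\<close>.\<close>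

lemma smooth_fun_base_pt:
  fixes A :: "('e::euclidean_space, 'm) atlas"
  assumes f: "smooth_fun A f"
  shows "smooth_fun (extended_tangent_atlas A a b) (f \<circ> base_pt)"
proof (rule smooth_funI)
  fix R \<rho> assume "(R, \<rho>) \<in> extended_tangent_atlas A a b"
  then obtain S \<psi> where S: "(S, \<psi>) \<in> A" and R: "R = (S \<times> UNIV) \<times> {a..b}"
      and \<rho>: "\<rho> = map_prod (\<lambda>(x, w). (\<psi> x, chart_vector A \<psi> x w)) (\<lambda>s. s)"
    by (auto simp: extended_tangent_atlas_def prod_atlas_def tangent_atlas_def)
  define pr :: "('e \<times> 'e) \<times> real \<Rightarrow> 'e" where "pr = (\<lambda>x. fst (fst x))"
  have "bounded_linear pr"
    unfolding pr_def by (intro bounded_linear_compose[OF bounded_linear_fst bounded_linear_fst])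
  then have "smooth_on R ((\<lambda>x. f (\<psi> x)) \<circ> pr)"
    by (rule smooth_on_compose_linear[OF _ smooth_funD[OF f S]]) (auto simp: R pr_def)
  then show "smooth_on R (\<lambda>x. (f \<circ> base_pt) (\<rho> x))"
    by (rule smooth_on_cong) (auto simp: \<rho> pr_def base_pt_def)
qed

theorem mainTheorem2:
  fixes Q :: "('q, 'z) monoid_scheme" and T :: "'q topology"
    and A :: "(real ^ 'n, 'q) atlas"
    and a b :: real
    and B :: "'n \<Rightarrow> 'q vfield" and \<beta> :: "'n \<Rightarrow> 'q form1" and c :: "'n \<Rightarrow> 'n \<Rightarrow> 'n \<Rightarrow> real"
    and M :: "(((real ^ 'n) \<times> (real ^ 'n)) \<times> real, 'q ext_point) atlas"
    and \<theta> :: "'n \<Rightarrow> 'q ext_point form1"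
    and \<xi> :: "'n \<Rightarrow> 'q ext_point \<Rightarrow> real"
    and Eq E\<xi> :: "'n \<Rightarrow> 'q ext_point vfield"
    and Es :: "'q ext_point vfield"
    and L H :: "'q ext_point \<Rightarrow> real"
    and p :: "'n \<Rightarrow> 'q ext_point \<Rightarrow> real"
    and \<Theta> :: "'q ext_point form1"
    and Dq Dp :: "'n \<Rightarrow> 'q ext_point vfield"
    and Ds :: "'q ext_point vfield"
    and J :: "'q ext_point \<Rightarrow> 'q ext_point form1 \<Rightarrow>
              'q ext_point form1 \<Rightarrow> real"
    and br :: "('q ext_point \<Rightarrow> real) \<Rightarrow> ('q ext_point \<Rightarrow> real) \<Rightarrow>
               'q ext_point \<Rightarrow> real"
  assumes lie: "lie_group Q T A"
    and ab: "a < b"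
    and M: "M = extended_tangent_atlas A a b"
    and left_inv: "\<And>i. left_invariant Q A (B i)"
    and forms: "\<And>i. one_form A (\<beta> i)"
    and B_dual: "dual_frame A B \<beta>"
    and structure_constants: "\<And>i j q. q \<in> carrier Q \<Longrightarrow>
          lie_bracket (B i) (B j) q = (\<lambda>f. \<Sum>k\<in>UNIV. c k i j * B k q f)"
    and \<theta>: "\<And>i. \<theta> i = pullback A base_pt (\<beta> i)"
    and \<xi>: "\<And>i. \<xi> i = fibre_coord (\<beta> i)"
    and E_dual: "dual_frame M (join Eq E\<xi> Es)
          (join \<theta> (\<lambda>i. differential (\<xi> i)) (differential s_coord))"
    and L: "smooth_fun M L"
    and P: "\<And>m. m \<in> points M \<Longrightarrow>
          invertible ((\<chi> i j. E\<xi> i m (\<lambda>m'. E\<xi> j m' L)) :: real ^ 'n ^ 'n)"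
    and p: "\<And>i. p i = (\<lambda>m. E\<xi> i m L)"
    and H: "H = (\<lambda>m. (\<Sum>i\<in>UNIV. p i m * \<xi> i m) - L m)"
    and \<Theta>: "\<Theta> = (\<lambda>m v. (\<Sum>i\<in>UNIV. p i m * \<theta> i m v) - H m * differential s_coord m v)"
    and D_dual: "dual_frame M (join Dq Dp Ds)
          (join \<theta> (\<lambda>i. differential (p i)) (differential s_coord))"
    and J: "J = (\<lambda>m \<alpha> \<gamma>.
          (\<Sum>i\<in>UNIV. tensor_prod (Dq i) (Dp i) m \<alpha> \<gamma> - tensor_prod (Dp i) (Dq i) m \<alpha> \<gamma>) +
          (\<Sum>k\<in>UNIV. \<Sum>i\<in>UNIV. \<Sum>j\<in>UNIV.
             p k m * c k i j * tensor_prod (Dp j) (Dp i) m \<alpha> \<gamma>))"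
    and br: "br = (\<lambda>F G m. J m (differential F) (differential G))"
  shows "poisson_bracket M br \<and>
    (\<forall>X. vector_field M X \<longrightarrow>
       (\<forall>W. vector_field M W \<longrightarrow> (\<forall>m\<in>points M. ext_deriv \<Theta> X W m = 0)) \<longrightarrow>
         (\<forall>\<phi>. smooth_fun M \<phi> \<longrightarrow>
            (\<forall>m\<in>points M. X m \<phi> = differential s_coord m (X m) * (br \<phi> H m + Ds m \<phi>))) \<and>
         (\<forall>I \<gamma> K h. integral_curve M X I \<gamma> \<longrightarrow>
            is_interval K \<longrightarrow> h differentiable_on K \<longrightarrow> h ` K \<subseteq> I \<longrightarrow>
            (\<forall>s\<in>K. s_coord (\<gamma> (h s)) = s) \<longrightarrow>
            (\<forall>\<phi>. smooth_fun M \<phi> \<longrightarrow> (\<forall>s\<in>K.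
               ((\<lambda>u. \<phi> (\<gamma> (h u))) has_real_derivative br \<phi> H (\<gamma> (h s)) + Ds (\<gamma> (h s)) \<phi>)
                 (at s within K)))))"
proof -
  have points: "points A = carrier Q"
    using lie unfolding lie_group_def lie_group_axioms_def smooth_manifold_def by metis
  have field: "vector_field M (E\<xi> i)" for i
    using dual_frame_vector_field[OF E_dual, of "Inr (Inl i)"] by (simp add: join_def)
  have p_smooth: "smooth_fun M (p i)" for i
    unfolding p by (rule vector_field_smooth[OF field L])
  \<comment> \<open>Smoothness of \<open>s_coord\<close> and of each \<open>\<xi> i\<close> is read
    off from the duality with their differentials.\<close>
  have s_smooth: "smooth_fun M s_coord"
    by (rule dual_frame_differential_smooth[OF E_dual, of "Inr (Inr ())"]) (simp add: join_def)
  have \<xi>_smooth: "smooth_fun M (\<xi> i)" for i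
    by (rule dual_frame_differential_smooth[OF E_dual, of "Inr (Inl i)"]) (simp add: join_def)
  have H_smooth: "smooth_fun M H"
    unfolding H by (rule smooth_fun_diff[OF smooth_fun_sum[OF smooth_fun_mult[OF p_smooth \<xi>_smooth]] L])
  interpret momentum_frame A M base_pt B \<beta> c \<theta> p s_coord Dq Dp Ds
    by unfold_locales
      (fact points_extended_tangent_atlas[of _ A a b, folded M] smooth_fun_base_pt[of A _ a b, folded M]
        forms B_dual structure_constants[folded points] \<theta> p_smooth s_smooth D_dual)+
  have br_eq: "br = bracket"
    by (intro ext) (simp add: br J bracket_def tensor_prod_def differential_def)
  have \<Theta>_eq: "\<Theta> = (\<lambda>m v. canonical_form m v - H m * differential s_coord m v)"
    by (simp add: \<Theta> canonical_form_def)
  have null: "X m \<phi> = X m s_coord * (br \<phi> H m + Ds m \<phi>)"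
    if X: "vector_field M X"
      and null: "\<forall>W. vector_field M W \<longrightarrow> (\<forall>m\<in>points M. ext_deriv \<Theta> X W m = 0)"
      and \<phi>: "smooth_fun M \<phi>" and m: "m \<in> points M" for X \<phi> m
    unfolding br_eq using null m
    by (intro null_field[OF X H_smooth \<phi> m]) (simp add: \<Theta>_eq)
  show ?thesis
  proof (intro conjI allI impI ballI)
    show "poisson_bracket M br" unfolding br_eq by (rule poisson_bracket)
  next
    fix X \<phi> m
    assume "vector_field M X" "\<forall>W. vector_field M W \<longrightarrow> (\<forall>m\<in>points M. ext_deriv \<Theta> X W m = 0)"
      "smooth_fun M \<phi>" "m \<in> points M"
    then show "X m \<phi> = differential s_coord m (X m) * (br \<phi> H m + Ds m \<phi>)"
      unfolding differential_def by (rule null)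
  next
    fix X I \<gamma> K h \<phi> s
    assume X: "vector_field M X" "\<forall>W. vector_field M W \<longrightarrow> (\<forall>m\<in>points M. ext_deriv \<Theta> X W m = 0)"
      and \<gamma>: "integral_curve M X I \<gamma>" and "is_interval K"
      and h: "h differentiable_on K" and hK: "h ` K \<subseteq> I" and clock: "\<forall>s\<in>K. s_coord (\<gamma> (h s)) = s"
      and \<phi>: "smooth_fun M \<phi>" and s: "s \<in> K"
    \<comment> \<open>The evolution equation holds only at points of \<open>M\<close>, so the curve
      must be known to stay there.\<close>
    have "\<gamma> (h s) \<in> points M" using \<gamma> hK s unfolding integral_curve_def by blast
    from null[OF X \<phi> this] clock
    show "((\<lambda>u. \<phi> (\<gamma> (h u))) has_real_derivative br \<phi> H (\<gamma> (h s)) + Ds (\<gamma> (h s)) \<phi>) (at s within K)"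
      by (intro integral_curve_clock[OF \<gamma> h hK _ s_smooth \<phi> s]) auto
  qed
qed

end
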